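(* Consider the two-queue $k$-limited polling model with switch-over times described in the context, with $\lambda_2=\frac{1-\rho_1}{\mathbb{E}[B_2']}-\delta\omega$, where $\omega>0$ is a fixed constant and $0<\delta\ll1$, all other parameters being fixed, and assume $\lambda_1/k_1<\lambda_2/k_2$. Let $P_0(\xi)$, $\xi>0$, be the (leading-order as $\delta\downarrow0$) probability density of the scaled queue length $\delta N_2$ of $Q_2$. Then $$P_0(\xi)=\eta\,\mathrm{e}^{-\eta\xi},\qquad \eta=\frac{2\omega\,\mathbb{E}[B_2']^2}{2\frac{\lambda_1}{\mu_1^2}+\frac{1}{\mathbb{E}[B_2']}\left(1-\frac{\lambda_1}{\mu_1}\right)\mathbb{E}[B_2'^2]}.$$
   Context: Polling model. Parameters: $\lambda_i,\mu_i,\sigma_i>0$ and integers $k_i\ge 1$ ($i=1,2$). A single server alternately visits two queues $Q_1,Q_2$. Customers arrive at $Q_i$ according to independent Poisson processes of rate $\lambda_i$; service times at $Q_i$ are exponential with parameter $\mu_i$. A visit to $Q_i$ ends when $k_i$ customers have been served during this visit or $Q_i$ becomes empty, whichever occurs first (in particular customers arriving during the visit may be served in it). The server then switches to the other queue, which takes an exponential switch-over time $S_i$ with parameter $\sigma_i$. If at the end of the switch-over time that queue is empty, the server immediately starts switching back. Exception: if at the end of a switch-over time both queues are empty, the server waits until the first arrival, and then goes to the queue $Q_j$ of that arrival (incurring the switch-over time if it is at the other queue) to start a visit of at most $k_j$ services. All random variables are independent. Markov chain. The states are $(n_1,n_2,h)$, where $n_i$ is the number of customers in $Q_i$ (including the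 one in service) and $h\in\{1,\dots,k_1+k_2+2\}$ is the server state: $1\le h\le k_1$: serving the $h$-th customer of the current visit to $Q_1$; $h=k_1+1$: switching from $Q_1$ to $Q_2$; $k_1+2\le h\le k_1+1+k_2$: serving the $(h-k_1-1)$-th customer of the current visit to $Q_2$; $h=k_1+k_2+2$: switching from $Q_2$ to $Q_1$. $p(n_1,n_2,h)$ denotes the stationary probability, and $N_1,N_2$ the stationary queue lengths. Notation. $\rho_i=\lambda_i/\mu_i$; $S=S_1+S_2$ with independent summands, so $\mathbb{E}[S]=\frac1{\sigma_1}+\frac1{\sigma_2}$ and $\mathrm{Var}[S]=\frac1{\sigma_1^2}+\frac1{\sigma_2^2}$. Define $$\mathbb{E}[B_2']=\frac1{\mu_2}+\frac{\mathbb{E}[S]}{k_2},\quad \mathrm{Var}[B_2']=\frac1{\mu_2^2}+\frac{\mathrm{Var}[S]}{k_2},\quad \mathbb{E}[B_2'^2]=\mathrm{Var}[B_2']+\mathbb{E}[B_2']^2.$$ For $\delta>0$ the system is stable (the utilizations $u_i=\rho_1+\rho_2+\lambda_i\mathbb{E}[S]/k_i$ are less than $1$), and $u_2\uparrow1$ as $\delta\downarrow0$. The condition $\lambda_1/k_1<\lambda_2/k_2$ is to hold for all sufficiently small $\delta>0$. Scaling and expansion. Put $\xi=\delta n_2$ and $p(n_1,\xi/\delta,h)=\delta\,\phi_{n_1,h}(\xi,\delta)$ for $0<\xi=\mathcal{O}(1)$. As is standard in the singular-perturbation technique, $\phi_{n_1,h}$ is regarded as a smooth function of a continuous variable $\xi$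 and is taken to have an expansion $\phi_{n_1,h}(\xi,\delta)=\phi^{(0)}_{n_1,h}(\xi)+\delta\phi^{(1)}_{n_1,h}(\xi)+\delta^2\phi^{(2)}_{n_1,h}(\xi)+\cdots$ with smooth coefficients, which (with $\phi_{n_1,h}(\xi\pm\delta,\delta)$ Taylor-expanded in $\delta$) satisfies the balance equations order by order in $\delta$, sums over $n_1$ being taken term by term. $P_0(\xi)=\sum_{n_1\ge0}\sum_{h=1}^{k_1+k_2+2}\phi^{(0)}_{n_1,h}(\xi)$, which is normalized by $\int_0^\infty P_0(\xi)\,\mathrm{d}\xi=1$. *)

theory Defs
  imports
    "HOL-Analysis.Analysis"
    "HOL-Library.Landau_Symbols"
    "HOL-Computational_Algebra.Formal_Power_Series"
begin

text \<open>
  The parameters that do not depend on the scaling parameter \<open>\<delta>\<close>. The arrival rate at the second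
  queue does depend on it and is passed separately. The scalar type is left open, because the same
  balance equations are used over the reals and over formal power series in \<open>\<delta>\<close>.
\<close>

record 'a polling =
  lam1 :: 'a
  mu1 :: 'a
  mu2 :: 'a
  sig1 :: 'a
  sig2 :: 'a
  k1 :: nat
  k2 :: nat

definition admissible :: "real polling \<Rightarrow> bool" where
  "admissible P \<longleftrightarrow> lam1 P > 0 \<and> mu1 P > 0 \<and> mu2 P > 0 \<and> sig1 P > 0 \<and> sig2 P > 0
     \<and> k1 P \<ge> 1 \<and> k2 P \<ge> 1"

text \<open>
  A state is \<open>(n\<^sub>1, n\<^sub>2, h)\<close>. The server states \<open>1, \<dots>, k\<^sub>1\<close> are the services at the first queue,
  \<open>k\<^sub>1 + 1\<close> is the switch from the first to the second queue, \<open>k\<^sub>1 + 2, \<dots>, k\<^sub>1 + k\<^sub>2 + 1\<close> are the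
  services at the second queue, and \<open>k\<^sub>1 + k\<^sub>2 + 2\<close> is the switch from the second to the first queue.
  A server that waits in an empty system has no server state of its own; as nobody can be in service
  when the served queue is empty, waiting at the first queue is encoded as \<open>(0, 0, 1)\<close> and waiting
  at the second queue as \<open>(0, 0, k\<^sub>1 + 2)\<close>.
\<close>

type_synonym state = "nat \<times> nat \<times> nat"

definition idle :: "'a polling \<Rightarrow> state \<Rightarrow> bool" where
  "idle P s \<longleftrightarrow> s = (0, 0, 1) \<or> s = (0, 0, k1 P + 2)"

definition states :: "'a polling \<Rightarrow> state set" where
  "states P = {(n1, n2, h). 1 \<le> h \<and> h \<le> k1 P + k2 P + 2
     \<and> (h \<le> k1 P \<longrightarrow> n1 \<ge> 1 \<or> idle P (n1, n2, h))
     \<and> (k1 P + 2 \<le> h \<and> h \<le> k1 P + k2 P + 1 \<longrightarrow> n2 \<ge> 1 \<or> idle P (n1, n2, h))}"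

text \<open>\<open>Completion\<close> is the end of the service or of the switch-over time in progress.\<close>

datatype event = Arrival1 | Arrival2 | Completion

fun rate :: "('a::comm_ring_1) polling \<Rightarrow> 'a \<Rightarrow> state \<Rightarrow> event \<Rightarrow> 'a" where
  "rate P lam2 s Arrival1 = lam1 P"
| "rate P lam2 s Arrival2 = lam2"
| "rate P lam2 (n1, n2, h) Completion =
    (if idle P (n1, n2, h) then 0
     else if h \<le> k1 P then mu1 P
     else if h = k1 P + 1 then sig1 P
     else if h \<le> k1 P + k2 P + 1 then mu2 P
     else sig2 P)"

fun target :: "'a polling \<Rightarrow> state \<Rightarrow> event \<Rightarrow> state" where
  "target P (n1, n2, h) Arrival1 =
    (if (n1, n2, h) = (0, 0, k1 P + 2) then (1, 0, k1 P + k2 P + 2) else (n1 + 1, n2, h))"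
| "target P (n1, n2, h) Arrival2 =
    (if (n1, n2, h) = (0, 0, 1) then (0, 1, k1 P + 1) else (n1, n2 + 1, h))"
| "target P (n1, n2, h) Completion =
    (if idle P (n1, n2, h) then (n1, n2, h)
     else if h \<le> k1 P then (n1 - 1, n2, if n1 = 1 then k1 P + 1 else h + 1)
     else if h = k1 P + 1 then
       (if n2 > 0 then (n1, n2, k1 P + 2)
        else if n1 > 0 then (n1, n2, k1 P + k2 P + 2)
        else (0, 0, k1 P + 2))
     else if h \<le> k1 P + k2 P + 1 then (n1, n2 - 1, if n2 = 1 then k1 P + k2 P + 2 else h + 1)
     else
       (if n1 > 0 then (n1, n2, 1)
        else if n2 > 0 then (n1, n2, k1 P + 1)
        else (0, 0, 1)))"

definition incoming :: "'a polling \<Rightarrow> state \<Rightarrow> (state \<times> event) set" where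
  "incoming P s = {(s', e). s' \<in> states P \<and> target P s' e = s}"

text \<open>Finiteness of \<open>incoming\<close> makes the sum in the balance equation below meaningful.\<close>

lemma finite_incoming: "finite (incoming P s)"
proof -
  obtain n1 n2 h where s: "s = (n1, n2, h)"
    by (cases s) auto
  have "(UNIV :: event set) = {Arrival1, Arrival2, Completion}"
    using event.exhaust by auto
  then have fin: "finite (UNIV :: event set)"
    by (metis finite.emptyI finite_insert)
  have sub: "incoming P s \<subseteq> ({..n1 + 1} \<times> {..n2 + 1} \<times> {..k1 P + k2 P + 2}) \<times> UNIV"
  proof
    fix x assume x: "x \<in> incoming P s"
    obtain m1 m2 g e where xe: "x = ((m1, m2, g), e)"
      by (cases x) auto
    have st: "(m1, m2, g) \<in> states P" and t: "target P (m1, m2, g) e = (n1, n2, h)"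
      using x by (auto simp: incoming_def xe s)
    have "m1 \<le> n1 + 1 \<and> m2 \<le> n2 + 1"
      using t by (cases e) (auto split: if_splits)
    moreover have "g \<le> k1 P + k2 P + 2"
      using st by (auto simp: states_def)
    ultimately show "x \<in> ({..n1 + 1} \<times> {..n2 + 1} \<times> {..k1 P + k2 P + 2}) \<times> UNIV"
      by (auto simp: xe)
  qed
  show ?thesis
    using finite_subset[OF sub] fin by simp
qed

definition balanced ::
    "('a::comm_ring_1) polling \<Rightarrow> 'a \<Rightarrow> (state \<Rightarrow> 'a) \<Rightarrow> state \<Rightarrow> bool" where
  "balanced P lam2 p s \<longleftrightarrow>
     (\<Sum>e\<in>{Arrival1, Arrival2, Completion}. rate P lam2 s e) * p s
       = (\<Sum>(s', e)\<in>incoming P s. rate P lam2 s' e * p s')"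

definition stationary_distribution :: "real polling \<Rightarrow> real \<Rightarrow> (state \<Rightarrow> real) \<Rightarrow> bool" where
  "stationary_distribution P lam2 p \<longleftrightarrow>
     (\<forall>s. p s \<ge> 0) \<and> (\<forall>s. s \<notin> states P \<longrightarrow> p s = 0) \<and> (p has_sum 1) (states P)
     \<and> (\<forall>s\<in>states P. balanced P lam2 p s)"

definition mean_S :: "real polling \<Rightarrow> real" where
  "mean_S P = 1 / sig1 P + 1 / sig2 P"

definition var_S :: "real polling \<Rightarrow> real" where
  "var_S P = 1 / (sig1 P)\<^sup>2 + 1 / (sig2 P)\<^sup>2"

definition mean_B2 :: "real polling \<Rightarrow> real" where
  "mean_B2 P = 1 / mu2 P + mean_S P / real (k2 P)"

definition var_B2 :: "real polling \<Rightarrow> real" where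
  "var_B2 P = 1 / (mu2 P)\<^sup>2 + var_S P / real (k2 P)"

definition second_moment_B2 :: "real polling \<Rightarrow> real" where
  "second_moment_B2 P = var_B2 P + (mean_B2 P)\<^sup>2"

definition critical_lam2 :: "real polling \<Rightarrow> real" where
  "critical_lam2 P = (1 - lam1 P / mu1 P) / mean_B2 P"

definition heavy_lam2 :: "real polling \<Rightarrow> real \<Rightarrow> real \<Rightarrow> real" where
  "heavy_lam2 P \<omega> \<delta> = critical_lam2 P - \<delta> * \<omega>"

definition eta :: "real polling \<Rightarrow> real \<Rightarrow> real" where
  "eta P \<omega> = 2 * \<omega> * (mean_B2 P)\<^sup>2 /
     (2 * (lam1 P / (mu1 P)\<^sup>2)
      + 1 / mean_B2 P * (1 - lam1 P / mu1 P) * second_moment_B2 P)"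

definition smooth_pos :: "(real \<Rightarrow> real) \<Rightarrow> bool" where
  "smooth_pos f \<longleftrightarrow> (\<forall>j. ((deriv ^^ j) f) differentiable_on {0<..})"

text \<open>
  Below, \<open>\<phi> n\<^sub>1 h \<xi> \<delta>\<close> are the scaled stationary probabilities and \<open>c m n\<^sub>1 h \<xi>\<close> is the coefficient
  of \<open>\<delta>\<^sup>m\<close> in the expansion of \<open>\<phi> n\<^sub>1 h \<xi> \<delta>\<close>.
\<close>

definition scaled_stationary ::
    "real polling \<Rightarrow> real \<Rightarrow> (real \<Rightarrow> state \<Rightarrow> real) \<Rightarrow>
     (nat \<Rightarrow> nat \<Rightarrow> real \<Rightarrow> real \<Rightarrow> real) \<Rightarrow> bool" where
  "scaled_stationary P \<omega> p \<phi> \<longleftrightarrow>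
     (\<forall>\<^sub>F \<delta> in at_right 0.
        stationary_distribution P (heavy_lam2 P \<omega> \<delta>) (p \<delta>)
        \<and> (\<forall>n1 n2 h. n2 \<ge> 1 \<longrightarrow> p \<delta> (n1, n2, h) = \<delta> * \<phi> n1 h (\<delta> * real n2) \<delta>)
        \<and> (\<forall>n1 h. smooth_pos (\<lambda>\<xi>. \<phi> n1 h \<xi> \<delta>)))"

definition expansion ::
    "real polling \<Rightarrow> (nat \<Rightarrow> nat \<Rightarrow> real \<Rightarrow> real \<Rightarrow> real) \<Rightarrow>
     (nat \<Rightarrow> nat \<Rightarrow> nat \<Rightarrow> real \<Rightarrow> real) \<Rightarrow> bool" where
  "expansion P \<phi> c \<longleftrightarrow>
     (\<forall>n1. \<forall>h\<in>{1..k1 P + k2 P + 2}.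
        (\<forall>m. smooth_pos (c m n1 h))
        \<and> (\<forall>\<xi>>0. \<forall>M.
             (\<lambda>\<delta>. \<phi> n1 h \<xi> \<delta> - (\<Sum>m\<le>M. c m n1 h \<xi> * \<delta> ^ m)) \<in> O[at_right 0](\<lambda>\<delta>. \<delta> ^ Suc M)))"

text \<open>
  The formal power series in \<open>\<delta>\<close> that results from \<open>\<Sum>\<^sub>m f m (\<xi> + r \<delta>) \<delta>\<^sup>m\<close> by Taylor expansion of
  every coefficient at \<open>\<xi>\<close>.
\<close>

definition taylor_shift :: "(nat \<Rightarrow> real \<Rightarrow> real) \<Rightarrow> int \<Rightarrow> real \<Rightarrow> real fps" where
  "taylor_shift f r \<xi> =
     Abs_fps (\<lambda>m. \<Sum>j\<le>m. of_int r ^ j / fact j * (deriv ^^ j) (f (m - j)) \<xi>)"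

definition fps_polling :: "real polling \<Rightarrow> real fps polling" where
  "fps_polling P =
     \<lparr> lam1 = fps_const (lam1 P), mu1 = fps_const (mu1 P), mu2 = fps_const (mu2 P),
       sig1 = fps_const (sig1 P), sig2 = fps_const (sig2 P), k1 = k1 P, k2 = k2 P \<rparr>"

definition fps_heavy_lam2 :: "real polling \<Rightarrow> real \<Rightarrow> real fps" where
  "fps_heavy_lam2 P \<omega> = fps_const (critical_lam2 P) - fps_X * fps_const \<omega>"

text \<open>
  The balance equations, order by order in \<open>\<delta>\<close>: with \<open>\<xi> = \<delta> n\<^sub>2\<close>, a neighbouring state with
  second component \<open>m\<^sub>2\<close> contributes the expansion at \<open>\<delta> m\<^sub>2 = \<xi> + (m\<^sub>2 - n\<^sub>2) \<delta>\<close>, and the two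
  sides agree as formal power series, that is, coefficient by coefficient. The common factor \<open>\<delta>\<close>
  of all probabilities is cancelled. For fixed \<open>\<xi> > 0\<close> and small \<open>\<delta>\<close> the number \<open>n\<^sub>2\<close> is large, so
  the boundary equations \<open>n\<^sub>2 \<le> 1\<close> do not enter; for \<open>n\<^sub>2 \<ge> 2\<close> the equations do not depend on \<open>n\<^sub>2\<close>.
\<close>

definition balanced_order_by_order ::
    "real polling \<Rightarrow> real \<Rightarrow> (nat \<Rightarrow> nat \<Rightarrow> nat \<Rightarrow> real \<Rightarrow> real) \<Rightarrow> bool" where
  "balanced_order_by_order P \<omega> c \<longleftrightarrow>
     (\<forall>\<xi>>0. \<forall>n1 n2 h. n2 \<ge> 2 \<longrightarrow> (n1, n2, h) \<in> states P \<longrightarrow>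
        balanced (fps_polling P) (fps_heavy_lam2 P \<omega>)
          (\<lambda>(m1, m2, g). taylor_shift (\<lambda>m. c m m1 g) (int m2 - int n2) \<xi>) (n1, n2, h))"

text \<open>
  Sums over \<open>n\<^sub>1\<close> are taken term by term: they converge absolutely, and they may be differentiated
  with respect to \<open>\<xi>\<close> under the sum.
\<close>

definition termwise_summable ::
    "real polling \<Rightarrow> (nat \<Rightarrow> nat \<Rightarrow> nat \<Rightarrow> real \<Rightarrow> real) \<Rightarrow> bool" where
  "termwise_summable P c \<longleftrightarrow>
     (\<forall>m j. \<forall>h\<in>{1..k1 P + k2 P + 2}. \<forall>\<xi>>0.
        summable (\<lambda>n1. \<bar>(deriv ^^ j) (c m n1 h) \<xi>\<bar>)
        \<and> ((\<lambda>x. \<Sum>n1. (deriv ^^ j) (c m n1 h) x)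
             has_real_derivative (\<Sum>n1. (deriv ^^ Suc j) (c m n1 h) \<xi>)) (at \<xi>))"

definition leading_density ::
    "real polling \<Rightarrow> (nat \<Rightarrow> nat \<Rightarrow> nat \<Rightarrow> real \<Rightarrow> real) \<Rightarrow> real \<Rightarrow> real" where
  "leading_density P c \<xi> = (\<Sum>n1. \<Sum>h=1..k1 P + k2 P + 2. c 0 n1 h \<xi>)"

end

theory Submission
  imports Defs
begin

text \<open>
  At leading order the second queue never empties, so the server runs through a cyclic chain on
  \<open>(n\<^sub>1, h)\<close>. The usual argument would use its stationary distribution and moments of \<open>n\<^sub>1\<close>. Here
  everything follows from summing the equations instead. All balance equations have the form
  "backward difference in \<open>n\<^sub>1\<close> plus transfer between phases", where a sequence whose backward
  difference vanishes is zero. At order \<open>0\<close> this gives the cut equation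
  \<open>\<lambda>\<^sub>1 P(n) = \<mu>\<^sub>1 x(n + 1)\<close> and exhibits the defect between arrivals and departures at the second queue
  as the backward difference of an explicit potential. At order \<open>1\<close> the total balance is therefore
  again a pure backward difference and can be integrated; summing over \<open>n\<^sub>1\<close> needs only absolute
  convergence of the coefficients. The total balance at order \<open>2\<close>, summed over \<open>n\<^sub>1\<close>, then becomes
  \<open>P\<^sub>0'' = - \<eta> P\<^sub>0'\<close>, and integrability removes the constant from the solution.
\<close>

section \<open>Balance equations away from the boundary\<close>

text \<open>The value 0 in front keeps one form for all balance equations: at \<open>n1 = 0\<close>
  there is no inflow by an arrival at the first queue.\<close>

definition prev :: "(nat \<Rightarrow> 'a::zero) \<Rightarrow> nat \<Rightarrow> 'a" where
  "prev a n = (if n = 0 then 0 else a (n - 1))"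

text \<open>Phase \<open>j\<close> stands for the server state \<open>k1 P + 1 + j\<close>. These
  phases are traversed in a fixed order as long as the second queue does not run empty.\<close>

definition phase_rate :: "'a polling \<Rightarrow> nat \<Rightarrow> 'a" where
  "phase_rate P j = (if j = 0 then sig1 P else if j \<le> k2 P then mu2 P else sig2 P)"

definition departs :: "'a polling \<Rightarrow> nat \<Rightarrow> nat" where
  "departs P j = (if 1 \<le> j \<and> j \<le> k2 P then 1 else 0)"

definition completing :: "'a polling \<Rightarrow> state \<Rightarrow> state set" where
  "completing P s = {s' \<in> states P. target P s' Completion = s}"

text \<open>Arrivals that find the server idle end with \<open>n2 \<le> 1\<close>, so their special
  targets do not occur here. The condition on \<open>Arrival1\<close> remains because a service at
  the first queue with \<open>n1 - 1 = 0\<close> is not a state.\<close>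

lemma incoming_split:
  assumes s: "(n1, n2, h) \<in> states P" and n2: "n2 \<ge> 2"
  shows "incoming P (n1, n2, h) =
    (if n1 \<ge> 1 \<and> (n1 - 1, n2, h) \<in> states P then {((n1 - 1, n2, h), Arrival1)} else {})
    \<union> {((n1, n2 - 1, h), Arrival2)} \<union> (\<lambda>s'. (s', Completion)) ` completing P (n1, n2, h)"
    (is "_ = ?R")
proof (intro set_eqI iffI)
  fix x assume x: "x \<in> incoming P (n1, n2, h)"
  obtain m1 m2 g e where xe: "x = ((m1, m2, g), e)"
    by (cases x) auto
  have "(m1, m2, g) \<in> states P" and "target P (m1, m2, g) e = (n1, n2, h)"
    using x by (auto simp: incoming_def xe)
  then show "x \<in> ?R"
    unfolding xe using n2 by (cases e) (auto simp: completing_def split: if_splits)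
next
  fix x assume x: "x \<in> ?R"
  moreover have "(n1, n2 - 1, h) \<in> states P"
    using s n2 by (auto simp: states_def idle_def)
  ultimately show "x \<in> incoming P (n1, n2, h)"
    using n2 by (auto simp: incoming_def completing_def split: if_splits)
qed

lemma finite_completing: "finite (completing P s)"
proof -
  have "(\<lambda>s'. (s', Completion)) ` completing P s \<subseteq> incoming P s"
    by (auto simp: incoming_def completing_def)
  then have "finite ((\<lambda>s'. (s', Completion)) ` completing P s)"
    using finite_incoming finite_subset by blast
  then show ?thesis
    by (rule finite_imageD) (auto simp: inj_on_def)
qed

text \<open>By \<open>p0\<close>, a predecessor missing from \<open>states P\<close> contributes 0,
  so the arrival term is \<open>prev\<close> in every case.\<close>

lemma balanced_iff:
  assumes s: "(n1, n2, h) \<in> states P" and n2: "n2 \<ge> 2"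
    and p0: "\<forall>m\<ge>1. \<forall>h\<in>{1..k1 P}. p (0, m, h) = 0"
  shows "balanced P l2 p (n1, n2, h) \<longleftrightarrow>
    (lam1 P + l2 + rate P l2 (n1, n2, h) Completion) * p (n1, n2, h) =
      prev (\<lambda>n. lam1 P * p (n, n2, h)) n1 + l2 * p (n1, n2 - 1, h)
      + (\<Sum>s'\<in>completing P (n1, n2, h). rate P l2 s' Completion * p s')"
proof -
  let ?g = "\<lambda>(s', e). rate P l2 s' e * p s'"
  let ?A = "if n1 \<ge> 1 \<and> (n1 - 1, n2, h) \<in> states P then {((n1 - 1, n2, h), Arrival1)} else {}"
  let ?C = "(\<lambda>s'. (s', Completion)) ` completing P (n1, n2, h)"
  have "sum ?g (incoming P (n1, n2, h)) = sum ?g ?A + l2 * p (n1, n2 - 1, h) + sum ?g ?C"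
    unfolding incoming_split[OF s n2]
    by (subst sum.union_disjoint sum.union_disjoint;
        auto simp: finite_completing intro!: finite_imageI)+
  moreover have "sum ?g ?C = (\<Sum>s'\<in>completing P (n1, n2, h). rate P l2 s' Completion * p s')"
    by (subst sum.reindex) (auto simp: inj_on_def)
  moreover have "sum ?g ?A = prev (\<lambda>n. lam1 P * p (n, n2, h)) n1"
  proof (cases "n1 \<ge> 1 \<and> (n1 - 1, n2, h) \<notin> states P")
    case True
    then have "h \<in> {1..k1 P} \<and> n1 = 1"
      using s n2 by (auto simp: states_def idle_def)
    then have "p (n1 - 1, n2, h) = 0"
      using p0 n2 by auto
    then show ?thesis
      using True by (simp add: prev_def)
  next
    case False
    then show ?thesis
      by (auto simp: prev_def)
  qed
  ultimately show ?thesis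
    by (simp add: balanced_def distrib_right add.assoc)
qed

section \<open>Predecessors by a completion, and the resulting balance equations\<close>

lemma completing_first_service:
  assumes "n2 \<ge> 2" "n1 \<ge> 1" "k1 P \<ge> 1"
  shows "completing P (n1, n2, 1) = {(n1, n2, k1 P + k2 P + 2)}"
  using assms by (auto simp: completing_def states_def idle_def split: if_splits)

lemma completing_next_service:
  assumes "n2 \<ge> 2" "n1 \<ge> 1" "2 \<le> h" "h \<le> k1 P"
  shows "completing P (n1, n2, h) = {(Suc n1, n2, h - 1)}"
  using assms by (auto simp: completing_def states_def idle_def split: if_splits)

lemma completing_switch:
  assumes "n2 \<ge> 2" "n1 \<ge> 1" "k1 P \<ge> 1"
  shows "completing P (n1, n2, k1 P + 1) = {(Suc n1, n2, k1 P)}"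
  using assms by (auto simp: completing_def states_def idle_def split: if_splits)

text \<open>An empty first queue is left after any service that removed its last customer, or at
  once when the server arrives there and finds nobody.\<close>

lemma completing_switch_empty:
  assumes "n2 \<ge> 2" "k1 P \<ge> 1"
  shows "completing P (0, n2, k1 P + 1) =
    insert (0, n2, k1 P + k2 P + 2) ((\<lambda>h. (1, n2, h)) ` {1..k1 P})"
  using assms by (auto simp: completing_def states_def idle_def split: if_splits)

text \<open>With at least two customers left in the second queue, no visit to it ends early and no
  switch-over finds it empty. Hence each phase is entered only from the one before it.\<close>

lemma completing_later:
  assumes "n2 \<ge> 2" "1 \<le> j" "j \<le> k2 P + 1" "k1 P \<ge> 1" "k2 P \<ge> 1"
  shows "completing P (n1, n2, k1 P + 1 + j) = {(n1, n2 + departs P (j - 1), k1 P + j)}"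
  using assms by (auto simp: completing_def states_def idle_def departs_def split: if_splits)

lemma balance_later:
  fixes P :: "'a::comm_ring_1 polling"
  assumes k: "k1 P \<ge> 1" "k2 P \<ge> 1" and j: "1 \<le> j" "j \<le> k2 P + 1" and n2: "n2 \<ge> 2"
    and bal: "balanced P l2 p (n1, n2, k1 P + 1 + j)"
    and p0: "\<forall>m\<ge>1. \<forall>h\<in>{1..k1 P}. p (0, m, h) = 0"
  shows "(lam1 P + l2 + phase_rate P j) * p (n1, n2, k1 P + 1 + j) =
    prev (\<lambda>n. lam1 P * p (n, n2, k1 P + 1 + j)) n1 + l2 * p (n1, n2 - 1, k1 P + 1 + j)
    + phase_rate P (j - 1) * p (n1, n2 + departs P (j - 1), k1 P + j)"
proof -
  have s: "(n1, n2, k1 P + 1 + j) \<in> states P"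
    using j n2 by (auto simp: states_def)
  have r: "rate P l2 (n1, n2, k1 P + 1 + j) Completion = phase_rate P j"
    using j n2 by (auto simp: idle_def phase_rate_def)
  have r': "rate P l2 (n1, n2 + departs P (j - 1), k1 P + j) Completion = phase_rate P (j - 1)"
    using j n2 by (auto simp: idle_def phase_rate_def)
  show ?thesis
    using bal unfolding balanced_iff[where p = p, OF s n2 p0] completing_later[OF n2 j k] r
    by (simp only: r' sum.insert[OF finite.emptyI] empty_iff not_False_eq_True sum.empty add_0_right)
qed

text \<open>The services at the first queue and the switch away from it are lumped. For
  \<open>n1 = 0\<close> any service may lead to the switch, for \<open>n1 \<ge> 1\<close> only the
  last one, but the sum of the equations has the same form in both cases.\<close>

lemma balance_first:
  fixes P :: "'a::comm_ring_1 polling"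
  assumes k: "k1 P \<ge> 1" "k2 P \<ge> 1" and n2: "n2 \<ge> 2"
    and bal: "\<And>h. (n1, n2, h) \<in> states P \<Longrightarrow> balanced P l2 p (n1, n2, h)"
    and p0: "\<forall>m\<ge>1. \<forall>h\<in>{1..k1 P}. p (0, m, h) = 0"
  defines "X \<equiv> \<lambda>n. \<Sum>h=1..k1 P. p (n, n2, h)"
  defines "A \<equiv> \<lambda>n m. \<Sum>h=1..k1 P + 1. p (n, m, h)"
  shows "(lam1 P + l2) * A n1 n2 + mu1 P * X n1 + sig1 P * p (n1, n2, k1 P + 1) =
    prev (\<lambda>n. lam1 P * A n n2) n1 + l2 * A n1 (n2 - 1) + mu1 P * X (Suc n1)
    + sig2 P * p (n1, n2, k1 P + k2 P + 2)"
proof -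
  let ?K = "k1 P + k2 P + 2"
  note eq = balanced_iff[where p = p, OF _ n2 p0, THEN iffD1, OF _ bal]
  have rK: "rate P l2 (n, n2, ?K) Completion = sig2 P" for n
    using k by (auto simp: idle_def)
  have sw: "(n1, n2, k1 P + 1) \<in> states P"
    using n2 by (auto simp: states_def)
  have rsw: "rate P l2 (n1, n2, k1 P + 1) Completion = sig1 P"
    using n2 by (auto simp: idle_def)
  have rq: "rate P l2 (n, n2, h) Completion = mu1 P" if "h \<le> k1 P" for n h
    using that n2 by (auto simp: idle_def)
  have Asuc: "A n m = (\<Sum>h=1..k1 P. p (n, m, h)) + p (n, m, k1 P + 1)" for n m
    using k by (simp add: A_def)
  show ?thesis
  proof (cases "n1 = 0")
    case True
    have z: "p (0, m, h) = 0" if "1 \<le> m" "h \<in> {1..k1 P}" for m h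
      using that p0 by auto
    have X0: "X n1 = 0"
      using z n2 True by (auto simp: X_def)
    have A0: "A 0 m = p (0, m, k1 P + 1)" if "1 \<le> m" for m
      unfolding Asuc using z[OF that] by simp
    have "(\<Sum>s'\<in>completing P (n1, n2, k1 P + 1). rate P l2 s' Completion * p s')
      = sig2 P * p (n1, n2, ?K) + (\<Sum>h=1..k1 P. mu1 P * p (1, n2, h))"
      unfolding True completing_switch_empty[OF n2 k(1)]
      by (subst sum.insert; (subst sum.reindex)?)
        (auto simp: inj_on_def rK[unfolded add_2_eq_Suc'] rq simp del: rate.simps)
    then show ?thesis
      using eq[OF sw sw] n2 unfolding rsw X0
      by (auto simp: A0 True prev_def X_def sum_distrib_left algebra_simps)
  next
    case False
    then have n1: "n1 \<ge> 1" by simp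
    have sv: "(n1, n2, h) \<in> states P" if "h \<in> {1..k1 P}" for h
      using that n1 n2 by (auto simp: states_def)
    \<comment> \<open>The flow by completions into server state \<open>h\<close>. For
      \<open>n1 \<ge> 1\<close> the switch \<open>k1 P + 1\<close> is fed by the last service just
      as a further service would be, so it needs no case of its own.\<close>
    define inflow where "inflow = (\<lambda>h. if h = 1 then sig2 P * p (n1, n2, ?K) else mu1 P * p (Suc n1, n2, h - 1))"
    have service: "(lam1 P + l2 + mu1 P) * p (n1, n2, h) =
      prev (\<lambda>n. lam1 P * p (n, n2, h)) n1 + l2 * p (n1, n2 - 1, h) + inflow h" if h: "h \<in> {1..k1 P}" for h
    proof -
      have "(\<Sum>s'\<in>completing P (n1, n2, h). rate P l2 s' Completion * p s') = inflow h"
      proof (cases "h = 1")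
        case True
        then show ?thesis
          using completing_first_service[OF n2 n1 k(1)] rK by (simp add: inflow_def del: rate.simps)
      next
        case False
        moreover have "h - 1 \<le> k1 P"
          using h by auto
        ultimately show ?thesis
          using completing_next_service[OF n2 n1, where h = h and P = P] rq h by (simp add: inflow_def del: rate.simps)
      qed
      then show ?thesis
        using eq[OF sv[OF h] sv[OF h]] rq h by (auto simp del: rate.simps)
    qed
    have switch: "(lam1 P + l2 + sig1 P) * p (n1, n2, k1 P + 1) =
      prev (\<lambda>n. lam1 P * p (n, n2, k1 P + 1)) n1 + l2 * p (n1, n2 - 1, k1 P + 1) + inflow (k1 P + 1)"
      using eq[OF sw sw] rsw completing_switch[OF n2 n1 k(1)] rq k
      by (simp add: inflow_def del: rate.simps)
    have total_inflow: "(\<Sum>h=1..k1 P + 1. inflow h) = sig2 P * p (n1, n2, ?K) + mu1 P * X (Suc n1)"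
    proof -
      have "(\<Sum>h=1..k1 P + 1. inflow h) = inflow 1 + (\<Sum>h=Suc 1..k1 P + 1. inflow h)"
        by (rule sum.atLeast_Suc_atMost) simp
      also have "(\<Sum>h=Suc 1..k1 P + 1. inflow h) = (\<Sum>h=1..k1 P. inflow (Suc h))"
        by (simp only: sum.shift_bounds_cl_Suc_ivl Suc_eq_plus1[symmetric])
      also have "\<dots> = mu1 P * X (Suc n1)"
        by (simp add: inflow_def X_def sum_distrib_left)
      finally show ?thesis by (simp add: inflow_def)
    qed
    have prevA: "prev (\<lambda>n. lam1 P * A n n2) n1 =
       (\<Sum>h=1..k1 P. prev (\<lambda>n. lam1 P * p (n, n2, h)) n1) + prev (\<lambda>n. lam1 P * p (n, n2, k1 P + 1)) n1"
      unfolding Asuc by (simp add: prev_def sum_distrib_left algebra_simps)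
    have "(lam1 P + l2) * A n1 n2 + mu1 P * X n1 + sig1 P * p (n1, n2, k1 P + 1) =
      (\<Sum>h=1..k1 P. (lam1 P + l2 + mu1 P) * p (n1, n2, h)) + (lam1 P + l2 + sig1 P) * p (n1, n2, k1 P + 1)"
      by (simp add: Asuc X_def sum.distrib sum_distrib_left algebra_simps)
    also have "\<dots> = (\<Sum>h=1..k1 P. prev (\<lambda>n. lam1 P * p (n, n2, h)) n1 + l2 * p (n1, n2 - 1, h) + inflow h)
      + (prev (\<lambda>n. lam1 P * p (n, n2, k1 P + 1)) n1 + l2 * p (n1, n2 - 1, k1 P + 1) + inflow (k1 P + 1))"
      unfolding switch by (simp only: service cong: sum.cong)
    also have "\<dots> = prev (\<lambda>n. lam1 P * A n n2) n1 + l2 * A n1 (n2 - 1) + (\<Sum>h=1..k1 P + 1. inflow h)"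
      unfolding prevA by (simp add: Asuc sum.distrib sum_distrib_left algebra_simps)
    finally show ?thesis
      unfolding total_inflow by (simp add: algebra_simps)
  qed
qed

section \<open>Balance equations order by order\<close>

text \<open>
  The functions \<open>\<phi>\<close> are tied to probabilities only at lattice points. Letting \<open>\<delta>\<close> run through \<open>\<xi> / n\<close>
  makes the given \<open>\<xi>\<close> such a point.
\<close>

lemma coeff_vanishes_off_states:
  assumes sc: "scaled_stationary P \<omega> p \<phi>" and ex: "expansion P \<phi> c"
    and h: "h \<in> {1..k1 P}" and \<xi>: "\<xi> > 0"
  shows "c m 0 h \<xi> = 0"
proof (induction m rule: less_induct)
  case (less M)
  have "(\<lambda>\<delta>. \<phi> 0 h \<xi> \<delta> - (\<Sum>m\<le>M. c m 0 h \<xi> * \<delta> ^ m)) \<in> O[at_right 0](\<lambda>\<delta>. \<delta> ^ Suc M)"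
    using ex h \<xi> unfolding expansion_def by auto
  \<comment> \<open>The coefficients below order \<open>M\<close> vanish by induction.\<close>
  moreover have "(\<Sum>m\<le>M. c m 0 h \<xi> * \<delta> ^ m) = c M 0 h \<xi> * \<delta> ^ M" for \<delta>
    using less by (simp add: lessThan_Suc_atMost[symmetric])
  ultimately obtain C where C: "\<forall>\<^sub>F \<delta> in at_right 0.
      \<bar>\<phi> 0 h \<xi> \<delta> - c M 0 h \<xi> * \<delta> ^ M\<bar> \<le> C * \<bar>\<delta> ^ Suc M\<bar>"
    by (elim landau_o.bigE) (auto simp del: power_Suc)
  \<comment> \<open>At a lattice point outside the state space \<phi> is 0, so the remainder
    estimate bounds the coefficient itself, after division by \<open>\<delta> ^ M\<close>.\<close>
  have "\<forall>\<^sub>F \<delta> in at_right 0. \<forall>n\<ge>1. \<delta> * real n = \<xi> \<longrightarrow> \<bar>c M 0 h \<xi>\<bar> \<le> C * \<delta>"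
    using C sc[unfolded scaled_stationary_def] eventually_at_right_less[of 0]
  proof eventually_elim
    case (elim \<delta>)
    show ?case
    proof (intro allI impI)
      fix n :: nat assume n: "n \<ge> 1" and eq: "\<delta> * real n = \<xi>"
      have "(0, n, h) \<notin> states P"
        using h n by (auto simp: states_def idle_def)
      then have "p \<delta> (0, n, h) = 0"
        using elim(2) by (auto simp: stationary_distribution_def)
      moreover have "p \<delta> (0, n, h) = \<delta> * \<phi> 0 h (\<delta> * real n) \<delta>"
        using elim(2) n by blast
      ultimately have "\<phi> 0 h \<xi> \<delta> = 0"
        using elim(3) eq by simp
      then have "\<bar>c M 0 h \<xi>\<bar> * \<delta> ^ M \<le> C * \<delta> * \<delta> ^ M"
        using elim(1,3) by (simp add: abs_mult power_abs mult.assoc)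
      then show "\<bar>c M 0 h \<xi>\<bar> \<le> C * \<delta>"
        using elim(3) by simp
    qed
  qed
  then obtain b where b: "b > 0" "\<And>\<delta> n. 0 < \<delta> \<Longrightarrow> \<delta> < b \<Longrightarrow> n \<ge> 1 \<Longrightarrow> \<delta> * real n = \<xi> \<Longrightarrow> \<bar>c M 0 h \<xi>\<bar> \<le> C * \<delta>"
    by (auto simp: eventually_at_right_field)
  have lim: "(\<lambda>n. \<xi> / real n) \<longlonglongrightarrow> 0"
    by (rule lim_const_over_n)
  then have "\<forall>\<^sub>F n in sequentially. \<xi> / real n < b"
    using b(1) by (rule order_tendstoD)
  then have "\<forall>\<^sub>F n in sequentially. \<bar>c M 0 h \<xi>\<bar> \<le> C * (\<xi> / real n)"
    using eventually_ge_at_top[of 1]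
    by eventually_elim (rule b(2), use \<xi> in auto)
  moreover have "(\<lambda>n. C * (\<xi> / real n)) \<longlonglongrightarrow> C * 0"
    by (intro tendsto_mult tendsto_const lim)
  ultimately have "\<bar>c M 0 h \<xi>\<bar> \<le> C * 0"
    by (intro tendsto_lowerbound) auto
  then show ?case by simp
qed

text \<open>Vanishing on an open set passes to derivatives; \<open>taylor_shift\<close> of vanishing
  coefficients is therefore 0.\<close>

lemma deriv_iterate_zero:
  assumes "\<And>\<xi>. \<xi> > 0 \<Longrightarrow> f \<xi> = (0::real)" and "\<xi> > (0::real)"
  shows "(deriv ^^ j) f \<xi> = 0"
  using assms(2)
proof (induction j arbitrary: \<xi>)
  case 0
  then show ?case using assms(1) by simp
next
  case (Suc j)
  have "\<forall>\<^sub>F x in nhds \<xi>. (deriv ^^ j) f x = 0"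
    using eventually_nhds_in_open[of "{0<..}" \<xi>] Suc by (auto elim: eventually_mono)
  then have "deriv ((deriv ^^ j) f) \<xi> = deriv (\<lambda>_. 0) \<xi>"
    by (intro deriv_cong_ev) auto
  then show ?case by simp
qed

section \<open>Coefficients of the balance equations up to order 2\<close>

lemma taylor_shift_nth:
  "fps_nth (taylor_shift f r \<xi>) 0 = f 0 \<xi>"
  "fps_nth (taylor_shift f r \<xi>) 1 = f 1 \<xi> + of_int r * deriv (f 0) \<xi>"
  "fps_nth (taylor_shift f r \<xi>) 2 = f 2 \<xi> + of_int r * deriv (f 1) \<xi> + (of_int r)\<^sup>2 / 2 * (deriv ^^ 2) (f 0) \<xi>"
  by (simp_all add: taylor_shift_def numeral_2_eq_2)

lemma fps_polling_sel [simp]: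
  "lam1 (fps_polling P) = fps_const (lam1 P)" "mu1 (fps_polling P) = fps_const (mu1 P)"
  "mu2 (fps_polling P) = fps_const (mu2 P)" "sig1 (fps_polling P) = fps_const (sig1 P)"
  "sig2 (fps_polling P) = fps_const (sig2 P)" "k1 (fps_polling P) = k1 P" "k2 (fps_polling P) = k2 P"
  by (simp_all add: fps_polling_def)

lemma phase_rate_fps [simp]: "phase_rate (fps_polling P) j = fps_const (phase_rate P j)"
  by (simp add: phase_rate_def)

lemma departs_fps [simp]: "departs (fps_polling P) j = departs P j"
  by (simp add: departs_def)

lemma states_fps [simp]: "states (fps_polling P) = states P"
  by (simp add: states_def idle_def)

lemma fps_heavy_lam2_mult_nth:
  "fps_nth (fps_heavy_lam2 P \<omega> * F) m = critical_lam2 P * fps_nth F m - (if m = 0 then 0 else \<omega> * fps_nth F (m - 1))"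
  by (simp add: fps_heavy_lam2_def left_diff_distrib mult.assoc)

lemma fps_heavy_lam2_nth_0: "fps_nth (fps_heavy_lam2 P \<omega>) 0 = critical_lam2 P"
  by (simp add: fps_heavy_lam2_def)

lemma fps_nth_prev: "fps_nth (prev a n) m = prev (\<lambda>n. fps_nth (a n) m) n"
  by (simp add: prev_def)

definition nabla :: "(nat \<Rightarrow> real) \<Rightarrow> nat \<Rightarrow> real" where
  "nabla a n = a n - prev a n"

text \<open>
  The coefficient of \<open>\<delta>\<^sup>m\<close> in \<open>\<lambda>\<^sub>2 (\<phi>(\<xi>) - \<phi>(\<xi> - \<delta>))\<close>, in terms of \<open>f m j\<close>, the \<open>j\<close>-th derivative of
  the \<open>m\<close>-th coefficient of \<open>\<phi>\<close>.
\<close>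

definition arrival_coeff :: "real \<Rightarrow> real \<Rightarrow> nat \<Rightarrow> (nat \<Rightarrow> nat \<Rightarrow> real) \<Rightarrow> real" where
  "arrival_coeff L \<omega> m f =
    (if m = 0 then 0 else if m = 1 then L * f 0 1 else L * (f 1 1 - f 0 2 / 2) - \<omega> * f 0 1)"

text \<open>In the same notation, the coefficient for \<phi>(\<xi> + s \<delta>). The last branch is
  the formula for \<open>m = 2\<close>, which is why the following lemmas assume
  \<open>m \<le> 2\<close>.\<close>

definition shift_coeff :: "real \<Rightarrow> nat \<Rightarrow> (nat \<Rightarrow> nat \<Rightarrow> real) \<Rightarrow> real" where
  "shift_coeff s m f =
    (if m = 0 then f 0 0 else if m = 1 then f 1 0 + s * f 0 1 else f 2 0 + s * f 1 1 + s\<^sup>2 * f 0 2 / 2)"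

lemma taylor_shift_coeff:
  assumes "m \<le> 2"
  shows "fps_nth (taylor_shift f r \<xi>) m = shift_coeff (of_int r) m (\<lambda>m j. (deriv ^^ j) (f m) \<xi>)"
proof -
  consider "m = 0" | "m = 1" | "m = 2" using assms by linarith
  then show ?thesis by cases (auto simp only: taylor_shift_nth shift_coeff_def, auto)
qed

lemma arrival_coeff_taylor:
  assumes "m \<le> 2"
  shows "fps_nth (fps_heavy_lam2 P \<omega> * (taylor_shift f 0 \<xi> - taylor_shift f (-1) \<xi>)) m
    = arrival_coeff (critical_lam2 P) \<omega> m (\<lambda>m j. (deriv ^^ j) (f m) \<xi>)"
proof -
  consider "m = 0" | "m = 1" | "m = 2" using assms by linarith
  then show ?thesis
    by cases (simp_all add: fps_heavy_lam2_nth_0 fps_heavy_lam2_mult_nth taylor_shift_nth arrival_coeff_def taylor_shift_coeff shift_coeff_def algebra_simps)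
qed

lemma order_later:
  fixes P :: "real polling"
  assumes k: "k1 P \<ge> 1" "k2 P \<ge> 1" and bal: "balanced_order_by_order P \<omega> c"
    and c0: "\<And>m h \<xi>. h \<in> {1..k1 P} \<Longrightarrow> \<xi> > 0 \<Longrightarrow> c m 0 h \<xi> = 0"
    and \<xi>: "\<xi> > 0" and m: "m \<le> 2" and j: "1 \<le> j" "j \<le> k2 P + 1"
  defines "f \<equiv> \<lambda>m j n h. (deriv ^^ j) (c m n h) \<xi>"
  defines "h \<equiv> k1 P + 1 + j"
  shows "lam1 P * nabla (\<lambda>n. f m 0 n h) n + phase_rate P j * f m 0 n h
      + arrival_coeff (critical_lam2 P) \<omega> m (\<lambda>m j. f m j n h)
    = phase_rate P (j - 1) * shift_coeff (real (departs P (j - 1))) m (\<lambda>m j. f m j n (h - 1))"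
proof -
  \<comment> \<open>Only differences of second components enter the shifted series, so
    \<open>n2 = 2\<close> represents all interior states.\<close>
  let ?p = "\<lambda>(m1, m2, g). taylor_shift (\<lambda>m. c m m1 g) (int m2 - int 2) \<xi>"
  let ?T = "\<lambda>r n h. taylor_shift (\<lambda>m. c m n h) r \<xi>"
  have p0: "\<forall>m\<ge>1. \<forall>h\<in>{1..k1 (fps_polling P)}. ?p (0, m, h) = 0"
    by (auto simp: taylor_shift_def fps_eq_iff intro!: sum.neutral deriv_iterate_zero[OF c0] \<xi>)
  have "(n, 2, h) \<in> states P"
    using j by (auto simp: states_def h_def)
  then have "balanced (fps_polling P) (fps_heavy_lam2 P \<omega>) ?p (n, 2, h)"
    using bal \<xi> unfolding balanced_order_by_order_def by blast
  then have "(fps_const (lam1 P) + fps_heavy_lam2 P \<omega> + fps_const (phase_rate P j)) * ?T 0 n h =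
    prev (\<lambda>n. fps_const (lam1 P) * ?T 0 n h) n + fps_heavy_lam2 P \<omega> * ?T (-1) n h
    + fps_const (phase_rate P (j - 1)) * ?T (int (departs P (j - 1))) n (h - 1)"
    using balance_later[where P = "fps_polling P" and p = ?p and ?l2.0 = "fps_heavy_lam2 P \<omega>" and ?n1.0 = n
        and ?n2.0 = 2 and j = j] k j p0
    by (simp add: h_def)
  \<comment> \<open>The arrivals at the second queue are collected into one difference, whose
    constant coefficient is 0.\<close>
  then have "fps_const (lam1 P) * ?T 0 n h - prev (\<lambda>n. fps_const (lam1 P) * ?T 0 n h) n
    + fps_const (phase_rate P j) * ?T 0 n h + fps_heavy_lam2 P \<omega> * (?T 0 n h - ?T (-1) n h)
    = fps_const (phase_rate P (j - 1)) * ?T (int (departs P (j - 1))) n (h - 1)"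
    by (simp add: algebra_simps del: fps_const_add)
  from arg_cong[OF this, of "\<lambda>F. fps_nth F m"] show ?thesis
    using m by (simp only: fps_add_nth fps_sub_nth fps_mult_left_const_nth fps_nth_prev taylor_shift_coeff arrival_coeff_taylor)
      (auto simp: f_def nabla_def prev_def shift_coeff_def numeral_2_eq_2 le_Suc_eq right_diff_distrib)
qed

lemma order_first:
  fixes P :: "real polling"
  assumes k: "k1 P \<ge> 1" "k2 P \<ge> 1" and bal: "balanced_order_by_order P \<omega> c"
    and c0: "\<And>m h \<xi>. h \<in> {1..k1 P} \<Longrightarrow> \<xi> > 0 \<Longrightarrow> c m 0 h \<xi> = 0"
    and \<xi>: "\<xi> > 0" and m: "m \<le> 2"
  defines "f \<equiv> \<lambda>m j n h. (deriv ^^ j) (c m n h) \<xi>"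
  defines "X \<equiv> \<lambda>m j n. \<Sum>h=1..k1 P. f m j n h"
  defines "A \<equiv> \<lambda>m j n. \<Sum>h=1..k1 P + 1. f m j n h"
  shows "lam1 P * nabla (A m 0) n + mu1 P * X m 0 n + sig1 P * f m 0 n (k1 P + 1)
      + arrival_coeff (critical_lam2 P) \<omega> m (\<lambda>m j. A m j n)
    = mu1 P * X m 0 (Suc n) + sig2 P * f m 0 n (k1 P + k2 P + 2)"
proof -
  let ?p = "\<lambda>(m1, m2, g). taylor_shift (\<lambda>m. c m m1 g) (int m2 - int 2) \<xi>"
  let ?T = "\<lambda>r n h. taylor_shift (\<lambda>m. c m n h) r \<xi>"
  let ?X = "\<lambda>n. \<Sum>h=1..k1 P. ?T 0 n h"
  let ?A = "\<lambda>r n. \<Sum>h=1..k1 P + 1. ?T r n h"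
  have p0: "\<forall>m\<ge>1. \<forall>h\<in>{1..k1 (fps_polling P)}. ?p (0, m, h) = 0"
    by (auto simp: taylor_shift_def fps_eq_iff intro!: sum.neutral deriv_iterate_zero[OF c0] \<xi>)
  have "balanced (fps_polling P) (fps_heavy_lam2 P \<omega>) ?p (n, 2, h)" if "(n, 2, h) \<in> states P" for h
    using bal \<xi> that unfolding balanced_order_by_order_def by blast
  then have "(fps_const (lam1 P) + fps_heavy_lam2 P \<omega>) * ?A 0 n + fps_const (mu1 P) * ?X n
      + fps_const (sig1 P) * ?T 0 n (k1 P + 1) =
    prev (\<lambda>n. fps_const (lam1 P) * ?A 0 n) n + fps_heavy_lam2 P \<omega> * ?A (-1) n
      + fps_const (mu1 P) * ?X (Suc n) + fps_const (sig2 P) * ?T 0 n (k1 P + k2 P + 2)"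
    using balance_first[where P = "fps_polling P" and p = ?p and ?l2.0 = "fps_heavy_lam2 P \<omega>" and ?n1.0 = n
        and ?n2.0 = 2] k p0
    by (simp del: sum.cl_ivl_Suc)
  then have eq: "fps_const (lam1 P) * ?A 0 n - prev (\<lambda>n. fps_const (lam1 P) * ?A 0 n) n + fps_const (mu1 P) * ?X n
      + fps_const (sig1 P) * ?T 0 n (k1 P + 1)
      + (\<Sum>h=1..k1 P + 1. fps_heavy_lam2 P \<omega> * (?T 0 n h - ?T (-1) n h)) =
      fps_const (mu1 P) * ?X (Suc n) + fps_const (sig2 P) * ?T 0 n (k1 P + k2 P + 2)"
    by (simp add: algebra_simps sum_subtractf sum_distrib_left sum.distrib)
  have arr: "(\<Sum>h=1..k1 P + 1. arrival_coeff (critical_lam2 P) \<omega> m (\<lambda>m j. f m j n h))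
      = arrival_coeff (critical_lam2 P) \<omega> m (\<lambda>m j. A m j n)"
    unfolding arrival_coeff_def A_def by (auto simp: sum_distrib_left sum_subtractf sum_divide_distrib sum.distrib
        algebra_simps)
  have T0: "fps_nth (?T 0 n h) m = f m 0 n h" for n h
    unfolding taylor_shift_coeff[OF m]
    using m by (auto simp: f_def shift_coeff_def numeral_2_eq_2 le_Suc_eq)
  have "lam1 P * A m 0 n - prev (\<lambda>n. lam1 P * A m 0 n) n + mu1 P * X m 0 n + sig1 P * f m 0 n (k1 P + 1)
      + arrival_coeff (critical_lam2 P) \<omega> m (\<lambda>m j. A m j n)
    = mu1 P * X m 0 (Suc n) + sig2 P * f m 0 n (k1 P + k2 P + 2)"
    using arg_cong[OF eq, of "\<lambda>F. fps_nth F m"]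
    unfolding fps_add_nth fps_sub_nth fps_mult_left_const_nth fps_nth_prev fps_sum_nth T0
      arrival_coeff_taylor[OF m]
    unfolding arr[symmetric] by (simp only: f_def A_def X_def)
  then show ?thesis
    by (cases n) (simp_all add: nabla_def prev_def right_diff_distrib)
qed

section \<open>Sequences along the server cycle\<close>

lemma nabla_add: "nabla (\<lambda>n. a n + b n) n = nabla a n + nabla b n"
  by (simp add: nabla_def prev_def)

lemma nabla_diff: "nabla (\<lambda>n. a n - b n) n = nabla a n - nabla b n"
  by (simp add: nabla_def prev_def)

lemma nabla_cmult: "nabla (\<lambda>n. C * a n) n = C * nabla a n"
  by (simp add: nabla_def prev_def right_diff_distrib)

lemma nabla_divide: "nabla (\<lambda>n. a n / C) n = nabla a n / C"
  by (simp add: nabla_def prev_def diff_divide_distrib)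

lemma nabla_sum: "nabla (\<lambda>n. \<Sum>i\<in>I. a i n) n = (\<Sum>i\<in>I. nabla (a i) n)"
  by (simp add: nabla_def prev_def sum_subtractf)

text \<open>The 0 in front of the sequence excludes nonzero constants.\<close>

lemma nabla_eq_0_imp_eq_0: "(\<And>n. nabla a n = 0) \<Longrightarrow> a n = 0"
proof (induction n)
  case 0
  from 0[of 0] show ?case by (simp add: nabla_def prev_def)
next
  case (Suc n)
  from Suc.prems[of "Suc n"] Suc.IH[OF Suc.prems] show ?case by (simp add: nabla_def prev_def)
qed

text \<open>A sequence and its shift by one have the same sum. This removes all arrivals at the
  first queue when an equation is summed over \<open>n1\<close>.\<close>

lemma nabla_sums_0:
  assumes "summable a"
  shows "nabla a sums 0"
proof -
  have "(\<lambda>n. prev a n) sums suminf a"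
    using sums_Suc_imp[of "prev a"] summable_sums[OF assms] by (simp add: prev_def)
  from sums_diff[OF summable_sums[OF assms] this] show ?thesis
    by (simp add: nabla_def[abs_def])
qed

text \<open>
  In the application, \<open>x n\<close> collects the services at the first queue with \<open>n\<close> customers present there,
  \<open>c j n\<close> are the phases that follow (phase \<open>0\<close> and phase \<open>J\<close> are the two switch-over times), \<open>r j\<close> is
  the rate at which phase \<open>j\<close> ends, and \<open>s j\<close> counts the departures from the second queue at its end.
\<close>

locale server_cycle =
  fixes r s :: "nat \<Rightarrow> real" and J :: nat and lam mu :: real
  assumes r_pos: "j \<le> J \<Longrightarrow> r j > 0"
    and lam_pos: "0 < lam" and lam_less_mu: "lam < mu"
    and s_0: "s 0 = 0" and s_J: "s J = 0"
begin

definition total :: "(nat \<Rightarrow> real) \<Rightarrow> (nat \<Rightarrow> nat \<Rightarrow> real) \<Rightarrow> nat \<Rightarrow> real" where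
  "total x c n = x n + (\<Sum>j\<le>J. c j n)"

text \<open>The mean time in a cycle that is not spent serving the first queue.\<close>

definition T :: real where "T = (\<Sum>j\<le>J. 1 / r j)"

text \<open>Departures from the second queue per cycle, divided by the mean cycle length
  \<open>T / (1 - lam / mu)\<close>. For the polling system this is the critical arrival
  rate.\<close>

definition L :: real where "L = (1 - lam / mu) * (\<Sum>j\<le>J. s j) / T"

text \<open>Mean time from the end of phase 0 to the end of phase \<open>j\<close>.\<close>

definition elapsed :: "nat \<Rightarrow> real" where "elapsed j = (\<Sum>i=1..j. 1 / r i)"

text \<open>The excess of the order-1 flux of phase \<open>j\<close> over that of phase 0, in units
  of the order-0 flux: phase \<open>i\<close> gains by the departure that starts it and loses by the
  arrivals during it.\<close>

definition drift :: "nat \<Rightarrow> real" where "drift j = (\<Sum>i=1..j. s (i - 1) - L / r i)"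

text \<open>
  With \<open>R\<close> the common value of all phase fluxes \<open>r j * suminf (c j)\<close> at order \<open>0\<close>, the potential defined
  below sums to \<open>beta * R\<close>, and the defect between arrivals and departures at order \<open>1\<close> is
  \<open>kappa * R\<close>.
\<close>

definition beta :: real where
  "beta = lam * (\<Sum>j\<le>J. s j * elapsed j)
    - (\<Sum>j\<le>J. s j) / T * (lam / mu * (T / (1 - lam / mu)) + lam * (\<Sum>j\<le>J. elapsed j / r j))"

definition kappa :: real where
  "kappa = (\<Sum>j\<le>J. s j) / T * (beta / mu + (\<Sum>j\<le>J. drift j / r j)) - (\<Sum>j\<le>J. s j * drift j)"

lemma T_pos: "T > 0"
  unfolding T_def by (rule sum_pos) (auto simp: r_pos)

lemma mu_pos: "mu > 0"
  using lam_pos lam_less_mu by simp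

lemma rho_less_1: "lam / mu < 1"
  using lam_less_mu mu_pos by simp

lemma atMost_J: "{..J} = insert 0 {1..J}"
  by auto

text \<open>Transfers between phases cancel around the cycle. The terms \<open>d\<close> (arrivals
  at the second queue) and \<open>g\<close> (departures from it) are left abstract so that the lemma
  serves the orders 0, 1 and 2.\<close>

lemma total_balance:
  assumes x0: "x 0 = 0"
    and first: "\<And>n. lam * nabla (\<lambda>n. x n + c 0 n) n + mu * x n + r 0 * c 0 n + d 0 n = mu * x (Suc n) + r J * c J n"
    and later: "\<And>j n. 1 \<le> j \<Longrightarrow> j \<le> J \<Longrightarrow>
      lam * nabla (c j) n + r j * c j n + d j n = r (j - 1) * c (j - 1) n + g (j - 1) n"
    and J: "J \<ge> 1"
  shows "nabla (\<lambda>n. lam * total x c n - mu * x (Suc n)) n + (\<Sum>j\<le>J. d j n) = (\<Sum>j<J. g j n)"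
proof -
  have "(\<Sum>j=1..J. lam * nabla (c j) n + r j * c j n + d j n) = (\<Sum>j=1..J. r (j - 1) * c (j - 1) n + g (j - 1) n)"
    by (intro sum.cong refl later) auto
  also have "\<dots> = (\<Sum>j<J. r j * c j n + g j n)"
    by (rule sum.reindex_bij_witness[of _ Suc "\<lambda>j. j - 1"]) auto
  finally have "lam * (\<Sum>j=1..J. nabla (c j) n) + (\<Sum>j=1..J. r j * c j n) + (\<Sum>j=1..J. d j n)
    = (\<Sum>j<J. r j * c j n) + (\<Sum>j<J. g j n)"
    by (simp add: sum.distrib sum_distrib_left)
  moreover have "(\<Sum>j<J. r j * c j n) + r J * c J n = r 0 * c 0 n + (\<Sum>j=1..J. r j * c j n)"
    using sum.lessThan_Suc[of "\<lambda>j. r j * c j n" J, symmetric]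
    unfolding lessThan_Suc_atMost atMost_J by simp
  \<comment> \<open>At \<open>n = 0\<close> this uses \<open>x 0 = 0\<close>.\<close>
  moreover have "mu * nabla (\<lambda>n. x (Suc n)) n = mu * x (Suc n) - mu * x n"
    using x0 by (cases n) (auto simp: nabla_def prev_def right_diff_distrib)
  moreover have "nabla (total x c) n = nabla (\<lambda>n. x n + c 0 n) n + (\<Sum>j=1..J. nabla (c j) n)"
    unfolding total_def atMost_J by (simp add: nabla_add nabla_sum[symmetric])
  ultimately show ?thesis
    using first[of n] unfolding nabla_diff nabla_cmult atMost_J
    by (simp add: algebra_simps)
qed

section \<open>Solutions of the order-0 equations\<close>

context
  fixes x :: "nat \<Rightarrow> real" and c :: "nat \<Rightarrow> nat \<Rightarrow> real"
  assumes x0: "x 0 = 0" and J: "J \<ge> 1"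
    and first: "\<And>n. lam * nabla (\<lambda>n. x n + c 0 n) n + mu * x n + r 0 * c 0 n = mu * x (Suc n) + r J * c J n"
    and later: "\<And>j n. 1 \<le> j \<Longrightarrow> j \<le> J \<Longrightarrow> lam * nabla (c j) n + r j * c j n = r (j - 1) * c (j - 1) n"
begin

text \<open>Without sources the total balance is a vanishing backward difference. The result is the
  balance across the cut between \<open>n\<close> and \<open>n + 1\<close> customers in the first
  queue.\<close>

lemma cut_equation: "lam * total x c n = mu * x (Suc n)"
proof -
  have "nabla (\<lambda>n. lam * total x c n - mu * x (Suc n)) n = 0" for n
    using total_balance[of x c "\<lambda>_ _. 0" "\<lambda>_ _. 0" n] x0 first later J by simp
  from nabla_eq_0_imp_eq_0[OF this] show ?thesis by simp
qed

definition partial :: "nat \<Rightarrow> nat \<Rightarrow> real" where "partial j n = (\<Sum>i=1..j. c i n)"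

text \<open>The equations of the phases 1 to \<open>j\<close> telescope.\<close>

lemma flux: "j \<le> J \<Longrightarrow> r j * c j n = r 0 * c 0 n - lam * nabla (partial j) n"
proof (induction j)
  case 0
  then show ?case by (simp add: partial_def nabla_def prev_def)
next
  case (Suc j)
  have "nabla (partial (Suc j)) n = nabla (partial j) n + nabla (c (Suc j)) n"
    unfolding partial_def by (simp add: nabla_add)
  then show ?case
    using later[of "Suc j" n] Suc by (simp add: algebra_simps)
qed

definition potential :: "nat \<Rightarrow> real" where
  "potential n = lam * (\<Sum>j\<le>J. s j * partial j n)
    - (\<Sum>j\<le>J. s j) / T * (lam / mu * total x c n + lam * (\<Sum>j\<le>J. partial j n / r j))"

text \<open>Each phase is expressed by \<open>flux\<close> and the services by the cut equation, so
  that up to a backward difference the total is a multiple of \<open>r 0 * c 0 n\<close>.\<close>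

lemma total_eq_nabla:
  "(1 - lam / mu) * total x c n =
    T * (r 0 * c 0 n) - nabla (\<lambda>n. lam / mu * total x c n + lam * (\<Sum>j\<le>J. partial j n / r j)) n"
proof -
  have phase: "c j n = r 0 * c 0 n * (1 / r j) - lam * (nabla (partial j) n / r j)" if "j \<in> {..J}" for j
  proof -
    have "c j n = (r 0 * c 0 n - lam * nabla (partial j) n) / r j"
      using flux[of j n] r_pos[of j] that by (simp add: eq_divide_eq mult.commute)
    then show ?thesis
      by (simp add: diff_divide_distrib)
  qed
  have "(\<Sum>j\<le>J. c j n) = (\<Sum>j\<le>J. r 0 * c 0 n * (1 / r j) - lam * (nabla (partial j) n / r j))"
    by (rule sum.cong[OF refl phase])
  also have "\<dots> = T * (r 0 * c 0 n) - lam * (\<Sum>j\<le>J. nabla (partial j) n / r j)"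
    unfolding T_def sum_subtractf sum_distrib_left[symmetric] by simp
  finally have "total x c n = x n + T * (r 0 * c 0 n) - lam * (\<Sum>j\<le>J. nabla (partial j) n / r j)"
    by (simp add: total_def)
  \<comment> \<open>The cut equation shifted by one; at \<open>n = 0\<close> both sides are
    0.\<close>
  moreover have "x n = lam / mu * prev (total x c) n"
    using cut_equation[of "n - 1"] x0 mu_pos
    by (cases n) (simp_all add: prev_def eq_divide_eq mult.commute)
  moreover have "lam / mu * nabla (total x c) n = lam / mu * total x c n - lam / mu * prev (total x c) n"
    by (simp only: nabla_def right_diff_distrib)
  moreover have "(1 - lam / mu) * total x c n = total x c n - lam / mu * total x c n"
    by (simp only: left_diff_distrib mult_1)
  ultimately show ?thesis
    unfolding nabla_add nabla_cmult nabla_sum nabla_divide by linarith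
qed

text \<open>Up to backward differences, arrivals and departures are both multiples of
  \<open>r 0 * c 0 n\<close>. The value of \<open>L\<close> makes the multiples equal, and
  \<open>potential\<close> collects the differences.\<close>

lemma flux_defect: "L * total x c n - (\<Sum>j\<le>J. s j * (r j * c j n)) = nabla potential n"
proof -
  let ?S = "\<Sum>j\<le>J. s j"
  have "s j * (r j * c j n) = s j * (r 0 * c 0 n) - lam * (s j * nabla (partial j) n)" if "j \<in> {..J}" for j
    using flux[of j n] that by (simp only: atMost_iff right_diff_distrib mult.left_commute)
  then have "(\<Sum>j\<le>J. s j * (r j * c j n)) = (\<Sum>j\<le>J. s j * (r 0 * c 0 n) - lam * (s j * nabla (partial j) n))"
    by (rule sum.cong[OF refl])
  then have "(\<Sum>j\<le>J. s j * (r j * c j n)) = ?S * (r 0 * c 0 n) - lam * (\<Sum>j\<le>J. s j * nabla (partial j) n)"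
    by (simp add: sum_subtractf sum_distrib_left sum_distrib_right)
  moreover have "L * total x c n = ?S / T * ((1 - lam / mu) * total x c n)"
    by (simp add: L_def)
  ultimately show ?thesis
    unfolding total_eq_nabla potential_def nabla_diff nabla_cmult nabla_sum
    using T_pos by (simp add: right_diff_distrib)
qed

context
  assumes sumx: "summable x" and sumc: "\<And>j. j \<le> J \<Longrightarrow> summable (c j)"
begin

lemma sums_total: "total x c sums (suminf x + (\<Sum>j\<le>J. suminf (c j)))"
  unfolding total_def by (intro sums_add sums_sum summable_sums sumx) (auto intro: sumc)

lemma sums_partial: "j \<le> J \<Longrightarrow> partial j sums (\<Sum>i=1..j. suminf (c i))"
  unfolding partial_def by (intro sums_sum summable_sums) (auto intro: sumc)

text \<open>Every cycle passes each phase once; formally, the difference in \<open>flux\<close> sums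
  to 0.\<close>

lemma flux_suminf:
  assumes "j \<le> J"
  shows "r j * suminf (c j) = r 0 * suminf (c 0)"
proof -
  have "(\<lambda>n. r 0 * c 0 n - lam * nabla (partial j) n) sums (r 0 * suminf (c 0) - lam * 0)"
    using assms by (intro sums_diff sums_mult summable_sums sumc nabla_sums_0)
      (auto intro: sums_summable[OF sums_partial])
  then have "(\<lambda>n. r j * c j n) sums (r 0 * suminf (c 0))"
    using flux[OF assms] by simp
  moreover have "(\<lambda>n. r j * c j n) sums (r j * suminf (c j))"
    by (intro sums_mult summable_sums sumc assms)
  ultimately show ?thesis
    using sums_unique2 by blast
qed

lemma total_suminf: "(1 - lam / mu) * suminf (total x c) = T * (r 0 * suminf (c 0))"
proof -
  have "summable (\<lambda>n. lam / mu * total x c n + lam * (\<Sum>j\<le>J. partial j n / r j))"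
    using sums_total sums_partial
    by (intro summable_add summable_mult summable_sum summable_divide) (auto simp: sums_iff)
  from sums_diff[OF sums_mult[OF sums_mult[OF summable_sums[OF sumc]]] nabla_sums_0[OF this], of 0 T "r 0"]
  have "(\<lambda>n. (1 - lam / mu) * total x c n) sums (T * (r 0 * suminf (c 0)))"
    unfolding total_eq_nabla by simp
  moreover have "(\<lambda>n. (1 - lam / mu) * total x c n) sums ((1 - lam / mu) * suminf (total x c))"
    using sums_total by (intro sums_mult summable_sums) (auto simp: sums_iff)
  ultimately show ?thesis
    using sums_unique2 by blast
qed

lemma flux_total_suminf: "(\<Sum>j\<le>J. s j * (r j * suminf (c j))) = L * suminf (total x c)"
proof -
  have "(\<Sum>j\<le>J. s j * (r j * suminf (c j))) = (\<Sum>j\<le>J. s j) * (r 0 * suminf (c 0))"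
    unfolding sum_distrib_right
  proof (rule sum.cong[OF refl])
    fix j assume "j \<in> {..J}"
    then show "s j * (r j * suminf (c j)) = s j * (r 0 * suminf (c 0))"
      using flux_suminf[of j] by simp
  qed
  moreover have "L * suminf (total x c) = (\<Sum>j\<le>J. s j) / T * ((1 - lam / mu) * suminf (total x c))"
    by (simp add: L_def)
  ultimately show ?thesis
    using T_pos by (simp add: total_suminf)
qed

text \<open>As all summed fluxes agree, \<open>partial j\<close> sums to \<open>elapsed j\<close>
  and the total to the mean cycle length, each times the common flux.\<close>

lemma potential_sums: "potential sums (beta * (r 0 * suminf (c 0)))"
proof -
  let ?R = "r 0 * suminf (c 0)"
  have "(\<Sum>i=1..j. suminf (c i)) = elapsed j * ?R" if "j \<le> J" for j
    unfolding elapsed_def sum_distrib_right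
  proof (intro sum.cong refl)
    fix i assume "i \<in> {1..j}"
    then have "i \<le> J" using that by auto
    from flux_suminf[OF this] r_pos[OF this] show "suminf (c i) = 1 / r i * ?R"
      by (simp add: field_simps)
  qed
  then have part: "partial j sums (elapsed j * ?R)" if "j \<le> J" for j
    using sums_partial[OF that] that by simp
  have "suminf (total x c) = T / (1 - lam / mu) * ?R"
    using total_suminf rho_less_1 lam_less_mu by (simp add: eq_divide_eq mult.commute)
  then have "total x c sums (T / (1 - lam / mu) * ?R)"
    using sums_total summable_sums[of "total x c"] by (metis sums_summable)
  then have pot: "potential sums (lam * (\<Sum>j\<le>J. s j * (elapsed j * ?R))
    - (\<Sum>j\<le>J. s j) / T * (lam / mu * (T / (1 - lam / mu) * ?R) + lam * (\<Sum>j\<le>J. elapsed j * ?R / r j)))"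
    unfolding potential_def by (intro sums_diff sums_mult sums_add sums_sum sums_divide part) auto
  have eqs: "(\<Sum>j\<le>J. s j * (elapsed j * ?R)) = (\<Sum>j\<le>J. s j * elapsed j) * ?R"
    "(\<Sum>j\<le>J. elapsed j * ?R / r j) = (\<Sum>j\<le>J. elapsed j / r j) * ?R"
    unfolding sum_distrib_right by (auto intro!: sum.cong)
  have factor: "u * (a * R) - b * (v * (w * R) + u * (d * R)) = (u * a - b * (v * w + u * d)) * R"
    for a b d u v w R :: real
    by (simp add: algebra_simps)
  show ?thesis
    using pot unfolding eqs factor beta_def .
qed

text \<open>In the application \<open>x\<close>, \<open>c\<close> are \<xi>-derivatives at order 0
  and \<open>y\<close>, \<open>d\<close> the order-1 coefficients. The source in their total balance
  is the defect of \<open>x\<close>, \<open>c\<close>, a backward difference by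
  \<open>flux_defect\<close>. Integrating it gives a cut equation corrected by
  \<open>potential\<close>, which determines the sum of \<open>y\<close>.\<close>

lemma first_order:
  assumes y0: "y 0 = 0"
    and first1: "\<And>n. lam * nabla (\<lambda>n. y n + d 0 n) n + mu * y n + r 0 * d 0 n + L * (x n + c 0 n)
      = mu * y (Suc n) + r J * d J n"
    and later1: "\<And>j n. 1 \<le> j \<Longrightarrow> j \<le> J \<Longrightarrow> lam * nabla (d j) n + r j * d j n + L * c j n
      = r (j - 1) * (d (j - 1) n + s (j - 1) * c (j - 1) n)"
    and sumy: "summable y" and sumd: "\<And>j. j \<le> J \<Longrightarrow> summable (d j)"
  shows "L * suminf (total y d) - (\<Sum>j\<le>J. s j * (r j * suminf (d j))) = kappa * (r 0 * suminf (c 0))"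
proof -
  let ?R = "r 0 * suminf (c 0)" and ?S = "\<Sum>j\<le>J. s j"
  have tot: "total y d sums (suminf y + (\<Sum>j\<le>J. suminf (d j)))"
    unfolding total_def by (intro sums_add sums_sum summable_sums sumy) (auto intro: sumd)
  \<comment> \<open>The services at the first queue are lumped with phase 0, so its arrival term
    contains \<open>x n\<close>.\<close>
  have "nabla (\<lambda>n. lam * total y d n - mu * y (Suc n)) n + (\<Sum>j\<le>J. L * (if j = 0 then x n + c 0 n else c j n))
      = (\<Sum>j<J. s j * (r j * c j n))" for n
    by (rule total_balance) (use y0 first1 later1 J in \<open>auto simp: algebra_simps\<close>)
  moreover have "(\<Sum>j\<le>J. L * (if j = 0 then x n + c 0 n else c j n)) = L * total x c n" for n
    by (simp add: total_def sum_distrib_left atMost_J algebra_simps)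
  moreover have "(\<Sum>j<J. s j * (r j * c j n)) = (\<Sum>j\<le>J. s j * (r j * c j n))" for n
    by (simp add: lessThan_Suc_atMost[symmetric] s_J)
  ultimately have bal: "nabla (\<lambda>n. lam * total y d n - mu * y (Suc n)) n + L * total x c n
      = (\<Sum>j\<le>J. s j * (r j * c j n))" for n
    by metis
  have "nabla (\<lambda>n. lam * total y d n - mu * y (Suc n) + potential n) n = 0" for n
    using flux_defect[of n] bal[of n] by (simp add: nabla_add)
  from nabla_eq_0_imp_eq_0[OF this]
  have "lam * total y d n - mu * y (Suc n) + potential n = 0" for n .
  moreover have "(\<lambda>n. y (Suc n)) sums suminf y"
    using y0 sumy by (simp add: sums_Suc_iff summable_sums)
  with tot potential_sums have "(\<lambda>n. lam * total y d n - mu * y (Suc n) + potential n)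
      sums (lam * suminf (total y d) - mu * suminf y + beta * ?R)"
    by (intro sums_add sums_diff sums_mult) (auto simp: sums_iff)
  ultimately have cut: "lam * suminf (total y d) - mu * suminf y + beta * ?R = 0"
    by (simp add: sums_0 sums_unique2)

  \<comment> \<open>Summing the phase equations over \<open>n\<close> removes the differences and
    accumulates \<open>drift\<close>.\<close>
  have fl: "r j * suminf (d j) = r 0 * suminf (d 0) + drift j * ?R" if "j \<le> J" for j
    using that
  proof (induction j)
    case 0
    then show ?case by (simp add: drift_def)
  next
    case (Suc j)
    have "(\<lambda>n. lam * nabla (d (Suc j)) n + r (Suc j) * d (Suc j) n + L * c (Suc j) n)
      sums (lam * 0 + r (Suc j) * suminf (d (Suc j)) + L * suminf (c (Suc j)))"
      using Suc by (intro sums_add sums_mult nabla_sums_0 summable_sums sumc sumd) auto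
    moreover have "(\<lambda>n. r j * (d j n + s j * c j n)) sums (r j * (suminf (d j) + s j * suminf (c j)))"
      using Suc by (intro sums_add sums_mult summable_sums sumc sumd) auto
    ultimately have "r (Suc j) * suminf (d (Suc j)) + L * suminf (c (Suc j)) = r j * (suminf (d j) + s j * suminf (c j))"
      using later1[of "Suc j"] Suc.prems by (simp add: sums_unique2)
    moreover have "suminf (c (Suc j)) = ?R / r (Suc j)"
      using flux_suminf[of "Suc j"] r_pos[of "Suc j"] Suc.prems by (simp add: field_simps)
    moreover have "r j * (s j * suminf (c j)) = s j * ?R"
      using flux_suminf[of j] Suc.prems by (simp add: algebra_simps)
    ultimately have "r (Suc j) * suminf (d (Suc j))
        = r 0 * suminf (d 0) + (drift j + (s j - L / r (Suc j))) * ?R"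
      using Suc by (simp add: algebra_simps)
    also have "drift j + (s j - L / r (Suc j)) = drift (Suc j)"
      by (simp add: drift_def)
    finally show ?case .
  qed

  \<comment> \<open>The order-1 flux of phase 0 stays undetermined; it contributes
    \<open>?u * ?S\<close> to both sides of the defect and cancels.\<close>
  let ?u = "r 0 * suminf (d 0)"
  have "(\<Sum>j\<le>J. suminf (d j)) = (\<Sum>j\<le>J. ?u * (1 / r j) + ?R * (drift j / r j))"
  proof (intro sum.cong refl)
    fix j assume "j \<in> {..J}"
    then have "r j * suminf (d j) = ?u + drift j * ?R" "r j > 0"
      by (auto intro: fl r_pos)
    then have "suminf (d j) = (?u + drift j * ?R) / r j"
      by (simp add: eq_divide_eq mult.commute)
    then show "suminf (d j) = ?u * (1 / r j) + ?R * (drift j / r j)"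
      by (simp add: add_divide_distrib mult.commute)
  qed
  also have "\<dots> = ?u * T + ?R * (\<Sum>j\<le>J. drift j / r j)"
    unfolding T_def sum.distrib sum_distrib_left[symmetric] ..
  finally have phases: "(\<Sum>j\<le>J. suminf (d j)) = ?u * T + ?R * (\<Sum>j\<le>J. drift j / r j)" .
  have "mu * suminf y = lam * suminf (total y d) + beta * ?R"
    using cut by linarith
  then have "suminf y = (lam * suminf (total y d) + beta * ?R) / mu"
    using mu_pos by (metis less_irrefl nonzero_mult_div_cancel_left)
  then have "suminf y = lam / mu * suminf (total y d) + beta / mu * ?R"
    by (simp add: add_divide_distrib)
  moreover have "suminf (total y d) = suminf y + (\<Sum>j\<le>J. suminf (d j))"
    using tot by (simp add: sums_iff)
  moreover have "(1 - lam / mu) * suminf (total y d) = suminf (total y d) - lam / mu * suminf (total y d)"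
    by (simp only: left_diff_distrib mult_1)
  ultimately have "(1 - lam / mu) * suminf (total y d) = beta / mu * ?R + ?u * T + ?R * (\<Sum>j\<le>J. drift j / r j)"
    using phases by linarith
  moreover have "L * suminf (total y d) = ?S / T * ((1 - lam / mu) * suminf (total y d))"
    by (simp add: L_def)
  ultimately have "L * suminf (total y d) = ?S / T * (beta / mu * ?R + ?u * T + ?R * (\<Sum>j\<le>J. drift j / r j))"
    by (simp only:)
  also have "\<dots> = ?S / T * (beta / mu + (\<Sum>j\<le>J. drift j / r j)) * ?R + ?S / T * (?u * T)"
    by (simp only: distrib_left distrib_right mult_ac add_ac)
  also have "?S / T * (?u * T) = ?u * ?S"
    using T_pos by simp
  finally have "L * suminf (total y d) = ?S / T * (beta / mu + (\<Sum>j\<le>J. drift j / r j)) * ?R + ?u * ?S" .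
  moreover have "s j * (r j * suminf (d j)) = ?u * s j + ?R * (s j * drift j)" if "j \<in> {..J}" for j
    using fl[of j] that by (simp add: algebra_simps)
  then have "(\<Sum>j\<le>J. s j * (r j * suminf (d j))) = (\<Sum>j\<le>J. ?u * s j + ?R * (s j * drift j))"
    by (rule sum.cong[OF refl])
  then have "(\<Sum>j\<le>J. s j * (r j * suminf (d j))) = ?u * ?S + ?R * (\<Sum>j\<le>J. s j * drift j)"
    by (simp add: sum.distrib sum_distrib_left)
  ultimately show ?thesis
    unfolding kappa_def left_diff_distrib by (simp only: mult.commute[of ?R] add_diff_cancel_right' add_diff_cancel_left diff_diff_eq2 add.commute[of _ "?u * ?S"])
qed

end
end
end

section \<open>Evaluation of the constants\<close>

text \<open>
  Here \<open>k\<close> is \<open>k\<^sub>2\<close>, \<open>m\<close> is \<open>\<mu>\<^sub>1\<close>, and \<open>d\<close>, \<open>a\<close>, \<open>b\<close> are the means of \<open>S\<^sub>1\<close>, of a service at the second queue,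
  and of \<open>S\<^sub>2\<close>.
\<close>

lemma eta_algebra:
  fixes k a b d \<rho> m :: real
  assumes k: "k > 0" and T: "T = d + k * a + b" "T > 0" and w: "\<rho> < 1" and m: "m > 0"
    and L: "L = (1 - \<rho>) * k / T"
    and \<beta>: "\<beta> = \<rho> * m * (a * (k * (k + 1) / 2)) - k / T * (\<rho> * (T / (1 - \<rho>)) + \<rho> * m * (a\<^sup>2 * (k * (k + 1) / 2) + (k * a + b) * b))"
    and \<kappa>: "\<kappa> = k / T * (\<beta> / m + (a * (k * (k - 1) / 2) - L * a\<^sup>2 * (k * (k + 1) / 2) + b * (k - L * (k * a + b))))
      - (k * (k - 1) / 2 - L * a * (k * (k + 1) / 2))"
  shows "2 * (1 - \<rho>) * (k - \<kappa>) * (T / k) = k * (2 * (\<rho> / m) + 1 / (T / k) * (1 - \<rho>) * (a\<^sup>2 + (d\<^sup>2 + b\<^sup>2) / k + (T / k)\<^sup>2))"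
proof -
  let ?w = "1 - \<rho>" and ?h = "k * (k + 1) / 2" and ?g = "k * (k - 1) / 2"
  have w0: "?w \<noteq> 0" using w by simp
  have dT: "d = T - k * a - b" using T by simp
  have "(\<rho> * m * X - k / T * (\<rho> * (T / v) + \<rho> * m * Z)) / m = \<rho> * X - k * \<rho> / (v * m) - k / T * (\<rho> * Z)"
    if "v \<noteq> 0" for X Z v
    using that m T(2) by (simp add: field_simps)
  from this[OF w0] have \<beta>m: "\<beta> / m = \<rho> * a * ?h - k * \<rho> / (?w * m) - k / T * (\<rho> * (a\<^sup>2 * ?h + (k * a + b) * b))"
    unfolding \<beta> by (simp only: mult.assoc)
  have "2 * v * (k - (k / T * (B + A) - A')) * (T / k) = 2 * v * (T + T / k * A' - B - A)" for v A A' B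
    using k T(2) by (simp add: field_simps)
  then have "2 * ?w * (k - \<kappa>) * (T / k) = 2 * ?w * (T + T / k * (?g - L * a * ?h)
     - (\<rho> * a * ?h - k * \<rho> / (?w * m) - k / T * (\<rho> * (a\<^sup>2 * ?h + (k * a + b) * b)))
     - (a * ?g - L * a\<^sup>2 * ?h + b * (k - L * (k * a + b))))"
    unfolding \<kappa> \<beta>m .
  also have "\<dots> = 2 * (k * \<rho> / m) + 2 * ?w * (T + T / k * (?g - L * a * ?h)
     - (\<rho> * a * ?h - k / T * (\<rho> * (a\<^sup>2 * ?h + (k * a + b) * b)))
     - (a * ?g - L * a\<^sup>2 * ?h + b * (k - L * (k * a + b))))"
    using w0 m by (simp add: field_simps)
  \<comment> \<open>Inserting \<open>L\<close> and \<open>d\<close> eliminates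
    \<open>\<rho>\<close>. On the right, \<open>k * a\<^sup>2 + d\<^sup>2 + b\<^sup>2\<close> is the
    variance of the time taken by \<open>k\<close> services and both switch-overs.\<close>
  also have "T + T / k * (?g - L * a * ?h)
     - (\<rho> * a * ?h - k / T * (\<rho> * (a\<^sup>2 * ?h + (k * a + b) * b)))
     - (a * ?g - L * a\<^sup>2 * ?h + b * (k - L * (k * a + b)))
    = (k * (k * a\<^sup>2 + d\<^sup>2 + b\<^sup>2) + T\<^sup>2) / (2 * T)"
    using k T(2) unfolding L dT
    by (simp add: field_simps) (simp add: algebra_simps power2_eq_square)
  also have "2 * (k * \<rho> / m) + 2 * ?w * \<dots>
    = k * (2 * (\<rho> / m) + 1 / (T / k) * ?w * (a\<^sup>2 + (d\<^sup>2 + b\<^sup>2) / k + (T / k)\<^sup>2))"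
    using k T(2) m by (simp add: field_simps power2_eq_square)
  finally show ?thesis .
qed

lemma sum_phases: "(\<Sum>j\<le>K + 1. g j) = g 0 + (\<Sum>j=1..K. g j) + g (K + 1)"
  for g :: "nat \<Rightarrow> real"
proof -
  have "{..K + 1} = insert 0 (insert (K + 1) {1..K})"
    by auto
  then show ?thesis
    by simp
qed

lemma sum_Suc_gauss: "(\<Sum>j=1..K. real j) = real K * (real K + 1) / 2"
  by (induction K) (simp_all add: field_simps)

text \<open>Identifies the abstract cycle constants with those of the model. The last conclusion
  puts \<open>kappa\<close> in the form that produces the denominator of \<open>eta\<close>.\<close>

lemma kappa_polling:
  assumes adm: "admissible P" and less: "lam1 P < mu1 P"
  defines "r \<equiv> phase_rate P" and "s \<equiv> \<lambda>j. real (departs P j)" and "J \<equiv> k2 P + 1"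
  shows "server_cycle r s J (lam1 P) (mu1 P)"
    and "server_cycle.T r J = real (k2 P) * mean_B2 P"
    and "(\<Sum>j\<le>J. s j) = real (k2 P)"
    and "server_cycle.L r s J (lam1 P) (mu1 P) = critical_lam2 P"
    and "2 * (1 - lam1 P / mu1 P) * (real (k2 P) - server_cycle.kappa r s J (lam1 P) (mu1 P)) * mean_B2 P
      = real (k2 P) * (2 * (lam1 P / (mu1 P)\<^sup>2) + 1 / mean_B2 P * (1 - lam1 P / mu1 P) * second_moment_B2 P)"
proof -
  have pos: "lam1 P > 0" "mu1 P > 0" "mu2 P > 0" "sig1 P > 0" "sig2 P > 0" "k2 P \<ge> 1"
    using adm by (auto simp: admissible_def)
  show cyc: "server_cycle r s J (lam1 P) (mu1 P)"
    using pos less by unfold_locales (auto simp: r_def s_def J_def phase_rate_def departs_def)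
  interpret server_cycle r s J "lam1 P" "mu1 P"
    by (rule cyc)
  define k a b d \<rho> where "k = real (k2 P)" and "a = 1 / mu2 P" and "b = 1 / sig2 P"
    and "d = 1 / sig1 P" and "\<rho> = lam1 P / mu1 P"
  have k: "k > 0" using pos by (simp add: k_def)
  have rj: "1 / r 0 = d" "j \<in> {1..k2 P} \<Longrightarrow> 1 / r j = a" "1 / r J = b" for j
    by (auto simp: r_def phase_rate_def J_def a_def b_def d_def)
  have sj: "s 0 = 0" "j \<in> {1..k2 P} \<Longrightarrow> s j = 1" "s J = 0" for j
    by (auto simp: s_def departs_def J_def)
  have split: "(\<Sum>j\<le>J. g j) = g 0 + (\<Sum>j=1..k2 P. g j) + g J" for g :: "nat \<Rightarrow> real"
    unfolding J_def by (rule sum_phases)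
  have T: "T = d + k * a + b"
    unfolding T_def split by (simp add: rj k_def)
  show TE: "T = real (k2 P) * mean_B2 P"
    using pos unfolding T by (simp add: mean_B2_def mean_S_def k_def a_def b_def d_def field_simps)
  show S: "(\<Sum>j\<le>J. s j) = real (k2 P)"
    unfolding split by (simp add: sj)
  show LL: "L = critical_lam2 P"
    using pos unfolding L_def S TE by (simp add: critical_lam2_def)
  have elapsed: "elapsed j = real j * a" if "j \<in> {1..k2 P}" for j
  proof -
    have "elapsed j = (\<Sum>i=1..j. a)"
      unfolding elapsed_def using that by (intro sum.cong rj) auto
    then show ?thesis by simp
  qed
  have elapsed_J: "elapsed J = k * a + b"
  proof -
    have "elapsed J = (\<Sum>i=1..k2 P. 1 / r i) + 1 / r J"
      unfolding elapsed_def J_def by simp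
    also have "(\<Sum>i=1..k2 P. 1 / r i) = (\<Sum>i=1..k2 P. a)"
      by (intro sum.cong rj) auto
    finally show ?thesis by (simp add: rj k_def)
  qed
  \<comment> \<open>There are \<open>Suc j\<close> terms but only \<open>j\<close> departures, since
    phase 0 has none.\<close>
  have starts: "(\<Sum>i=1..Suc j. s (i - 1)) = real j" if "j \<le> k2 P" for j
  proof -
    have "(\<Sum>i=1..Suc j. s (i - 1)) = (\<Sum>i=1..j. s i)"
      using sj(1) by (simp add: sum.shift_bounds_cl_Suc_ivl sum.atLeast_Suc_atMost atLeast0AtMost[symmetric] del: sum.cl_ivl_Suc)
    also have "\<dots> = (\<Sum>i=1..j. 1)"
      using that by (intro sum.cong sj) auto
    finally show ?thesis by simp
  qed
  have drift_eq: "drift (Suc j) = real j - L * elapsed (Suc j)" if "j \<le> k2 P" for j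
    unfolding drift_def sum_subtractf starts[OF that] by (simp add: elapsed_def sum_distrib_left del: sum.cl_ivl_Suc)
  have drift: "drift j = real j - 1 - L * (real j * a)" if "j \<in> {1..k2 P}" for j
  proof -
    have "j - 1 \<le> k2 P" "Suc (j - 1) = j" "real (j - 1) = real j - 1"
      using that by auto
    then show ?thesis
      using drift_eq[of "j - 1"] elapsed[OF that] by simp
  qed
  have drift_J: "drift J = k - L * (k * a + b)"
    using drift_eq[of "k2 P"] elapsed_J by (simp add: J_def k_def)
  have zero: "elapsed 0 = 0" "drift 0 = 0"
    by (simp_all add: elapsed_def drift_def)
  let ?h = "k * (k + 1) / 2" and ?g = "k * (k - 1) / 2"
  have sum1: "(\<Sum>j=1..k2 P. real j * C) = C * ?h" for C
    unfolding sum_distrib_right[symmetric] sum_Suc_gauss k_def by simp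
  have sum2: "(\<Sum>j=1..k2 P. real j - 1 - L * (real j * a)) = ?g - L * a * ?h"
  proof -
    have "(\<Sum>j=1..k2 P. real j - 1 - L * (real j * a)) = (\<Sum>j=1..k2 P. real j * (1 - L * a) - 1)"
      by (intro sum.cong refl) (simp add: algebra_simps)
    also have "\<dots> = (1 - L * a) * ?h - k"
      unfolding sum_subtractf sum1 by (simp add: k_def)
    finally show ?thesis
      by (simp add: field_simps)
  qed
  have "(\<Sum>j=1..k2 P. s j * elapsed j) = (\<Sum>j=1..k2 P. real j * a)"
    by (intro sum.cong) (simp_all add: sj elapsed)
  then have s1: "(\<Sum>j\<le>J. s j * elapsed j) = a * ?h"
    unfolding split sum1 sj(1,3) by simp
  have "(\<Sum>j=1..k2 P. elapsed j * (1 / r j)) = (\<Sum>j=1..k2 P. real j * a\<^sup>2)"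
    by (intro sum.cong refl) (simp only: rj elapsed power2_eq_square mult.assoc)
  then have s2: "(\<Sum>j\<le>J. elapsed j * (1 / r j)) = a\<^sup>2 * ?h + (k * a + b) * b"
    unfolding split sum1 rj(1,3) elapsed_J zero by simp
  have "(\<Sum>j=1..k2 P. s j * drift j) = (\<Sum>j=1..k2 P. real j - 1 - L * (real j * a))"
    by (intro sum.cong) (simp_all add: sj drift)
  then have s3: "(\<Sum>j\<le>J. s j * drift j) = ?g - L * a * ?h"
    unfolding split sum2 sj(1,3) by simp
  have "(\<Sum>j=1..k2 P. drift j * (1 / r j)) = (\<Sum>j=1..k2 P. (real j - 1 - L * (real j * a)) * a)"
    by (intro sum.cong refl) (simp only: rj drift)
  then have s4: "(\<Sum>j\<le>J. drift j * (1 / r j)) = (?g - L * a * ?h) * a + (k - L * (k * a + b)) * b"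
    unfolding split rj(1,3) drift_J zero sum_distrib_right[symmetric] sum2 by simp
  have lam: "lam1 P = \<rho> * mu1 P"
    using pos by (simp add: \<rho>_def)
  have beta: "beta = \<rho> * mu1 P * (a * ?h) - k / T * (\<rho> * (T / (1 - \<rho>)) + \<rho> * mu1 P * (a\<^sup>2 * ?h + (k * a + b) * b))"
    using s1 s2 unfolding beta_def S k_def[symmetric] \<rho>_def[symmetric] lam[symmetric] by simp
  have kappa: "kappa = k / T * (beta / mu1 P + (a * ?g - L * a\<^sup>2 * ?h + b * (k - L * (k * a + b))))
      - (?g - L * a * ?h)"
  proof -
    have "(\<Sum>j\<le>J. drift j / r j) = a * ?g - L * a\<^sup>2 * ?h + b * (k - L * (k * a + b))"
      using s4 by (simp add: algebra_simps power2_eq_square)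
    then show ?thesis
      unfolding kappa_def S k_def[symmetric] s3 by simp
  qed
  have L: "L = (1 - \<rho>) * k / T"
    unfolding L_def S by (simp add: k_def \<rho>_def)
  have "2 * (1 - \<rho>) * (k - kappa) * (T / k) = k * (2 * (\<rho> / mu1 P) + 1 / (T / k) * (1 - \<rho>) * (a\<^sup>2 + (d\<^sup>2 + b\<^sup>2) / k + (T / k)\<^sup>2))"
    by (rule eta_algebra[OF k T T_pos _ pos(2) L beta kappa]) (use rho_less_1 in \<open>simp add: \<rho>_def\<close>)
  moreover have "T / k = mean_B2 P"
    using k by (simp add: TE k_def)
  moreover have "a\<^sup>2 + (d\<^sup>2 + b\<^sup>2) / k + (mean_B2 P)\<^sup>2 = second_moment_B2 P"
    by (simp add: second_moment_B2_def var_B2_def var_S_def a_def d_def b_def k_def power_one_over)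
  moreover have "\<rho> / mu1 P = lam1 P / (mu1 P)\<^sup>2"
    by (simp add: \<rho>_def power2_eq_square)
  ultimately show "2 * (1 - lam1 P / mu1 P) * (real (k2 P) - kappa) * mean_B2 P
      = real (k2 P) * (2 * (lam1 P / (mu1 P)\<^sup>2) + 1 / mean_B2 P * (1 - lam1 P / mu1 P) * second_moment_B2 P)"
    by (simp only: k_def \<rho>_def)
qed

section \<open>The differential equation for the leading density\<close>

lemma smooth_pos_has_derivative:
  assumes "smooth_pos g" "\<xi> > 0"
  shows "((deriv ^^ j) g has_real_derivative (deriv ^^ Suc j) g \<xi>) (at \<xi>)"
proof -
  have "(deriv ^^ j) g differentiable at \<xi>"
    using assms differentiable_on_eq_differentiable_at[OF open_greaterThan] by (auto simp: smooth_pos_def)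
  then show ?thesis
    by (simp add: DERIV_deriv_iff_real_differentiable)
qed

text \<open>The half-line is open, so identities valid for all positive \<xi> may be
  differentiated.\<close>

lemma derivatives_eq:
  fixes u v :: "real \<Rightarrow> real"
  assumes "\<And>x. x > 0 \<Longrightarrow> u x = v x" and "\<xi> > 0"
    and "(u has_real_derivative u') (at \<xi>)" "(v has_real_derivative v') (at \<xi>)"
  shows "u' = v'"
proof -
  have "(v has_real_derivative u') (at \<xi>)"
    using assms by (intro has_field_derivative_transform_within_open[OF assms(3), of "{0<..}"]) auto
  then show ?thesis
    using assms(4) DERIV_unique by blast
qed

lemma has_derivative_nabla:
  assumes "\<And>n. ((\<lambda>x. F n x) has_real_derivative F' n) (at \<xi>)"
  shows "((\<lambda>x. nabla (\<lambda>n. F n x) n) has_real_derivative nabla F' n) (at \<xi>)"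
  using assms by (cases n) (auto simp: nabla_def prev_def intro!: derivative_intros)

locale heavy_traffic =
  fixes P :: "real polling" and \<omega> :: real and c :: "nat \<Rightarrow> nat \<Rightarrow> nat \<Rightarrow> real \<Rightarrow> real"
  assumes adm: "admissible P" and less: "lam1 P < mu1 P"
    and bal: "balanced_order_by_order P \<omega> c"
    and vanish: "\<And>m h \<xi>. h \<in> {1..k1 P} \<Longrightarrow> \<xi> > 0 \<Longrightarrow> c m 0 h \<xi> = 0"
    and smooth: "\<And>m n h. h \<in> {1..k1 P + k2 P + 2} \<Longrightarrow> smooth_pos (c m n h)"
    and termwise: "termwise_summable P c"
begin

abbreviation r :: "nat \<Rightarrow> real" where "r \<equiv> phase_rate P"
abbreviation s :: "nat \<Rightarrow> real" where "s \<equiv> \<lambda>j. real (departs P j)"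
abbreviation J :: nat where "J \<equiv> k2 P + 1"

sublocale server_cycle r s J "lam1 P" "mu1 P"
  by (rule kappa_polling(1)[OF adm less])

text \<open>The indices are the order \<open>m\<close> in \<delta> and the number \<open>i\<close>
  of \<xi>-derivatives. With \<xi> ahead of the state, \<open>service m i \<xi>\<close> and
  \<open>phase m i \<xi>\<close> fit the abstract cycle as partial applications.\<close>

definition f :: "nat \<Rightarrow> nat \<Rightarrow> real \<Rightarrow> nat \<Rightarrow> nat \<Rightarrow> real" where
  "f m i \<xi> n h = (deriv ^^ i) (c m n h) \<xi>"

definition service :: "nat \<Rightarrow> nat \<Rightarrow> real \<Rightarrow> nat \<Rightarrow> real" where
  "service m i \<xi> n = (\<Sum>h=1..k1 P. f m i \<xi> n h)"

definition phase :: "nat \<Rightarrow> nat \<Rightarrow> real \<Rightarrow> nat \<Rightarrow> nat \<Rightarrow> real" where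
  "phase m i \<xi> j n = f m i \<xi> n (k1 P + 1 + j)"

definition mass :: "nat \<Rightarrow> nat \<Rightarrow> real \<Rightarrow> real" where
  "mass m i \<xi> = (\<Sum>n. total (service m i \<xi>) (phase m i \<xi>) n)"

lemma k_pos: "k1 P \<ge> 1" "k2 P \<ge> 1"
  using adm by (auto simp: admissible_def)

lemma L_eq: "L = critical_lam2 P"
  by (rule kappa_polling(4)[OF adm less])

lemma summable_f: "h \<in> {1..k1 P + k2 P + 2} \<Longrightarrow> \<xi> > 0 \<Longrightarrow> summable (\<lambda>n. f m i \<xi> n h)"
  using termwise unfolding termwise_summable_def f_def by (blast intro: summable_rabs_cancel)

lemma suminf_f_derivative:
  "h \<in> {1..k1 P + k2 P + 2} \<Longrightarrow> \<xi> > 0 \<Longrightarrow>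
    ((\<lambda>x. \<Sum>n. f m i x n h) has_real_derivative (\<Sum>n. f m (Suc i) \<xi> n h)) (at \<xi>)"
  using termwise unfolding termwise_summable_def f_def by blast

lemma summable_service: "\<xi> > 0 \<Longrightarrow> summable (service m i \<xi>)"
  unfolding service_def by (intro summable_sum summable_f) auto

lemma summable_phase: "j \<le> J \<Longrightarrow> \<xi> > 0 \<Longrightarrow> summable (phase m i \<xi> j)"
  unfolding phase_def by (intro summable_f) auto

lemma f_derivative:
  "h \<in> {1..k1 P + k2 P + 2} \<Longrightarrow> \<xi> > 0 \<Longrightarrow>
    ((\<lambda>x. f m i x n h) has_real_derivative f m (Suc i) \<xi> n h) (at \<xi>)"
  using smooth_pos_has_derivative[OF smooth] unfolding f_def by auto

lemma service_derivative:
  "\<xi> > 0 \<Longrightarrow> ((\<lambda>x. service m i x n) has_real_derivative service m (Suc i) \<xi> n) (at \<xi>)"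
  unfolding service_def by (intro DERIV_sum f_derivative) auto

lemma phase_derivative:
  "j \<le> J \<Longrightarrow> \<xi> > 0 \<Longrightarrow> ((\<lambda>x. phase m i x j n) has_real_derivative phase m (Suc i) \<xi> j n) (at \<xi>)"
  unfolding phase_def by (intro f_derivative) auto

lemma sum_states: "(\<Sum>h=1..k1 P + k2 P + 2. g h) = (\<Sum>h=1..k1 P. g h) + (\<Sum>j\<le>J. g (k1 P + 1 + j))"
  for g :: "nat \<Rightarrow> real"
proof -
  have "{1..k1 P + k2 P + 2} = {1..k1 P} \<union> (\<lambda>j. k1 P + 1 + j) ` {..J}"
  proof (intro equalityI subsetI)
    fix h assume "h \<in> {1..k1 P + k2 P + 2}"
    then show "h \<in> {1..k1 P} \<union> (\<lambda>j. k1 P + 1 + j) ` {..J}"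
      by (cases "h \<le> k1 P") (auto intro!: image_eqI[of _ _ "h - (k1 P + 1)"])
  qed auto
  then show ?thesis
    by (simp only:) (subst sum.union_disjoint, auto simp: sum.reindex inj_on_def)
qed

lemma total_eq_sum: "total (service m i \<xi>) (phase m i \<xi>) n = (\<Sum>h=1..k1 P + k2 P + 2. f m i \<xi> n h)"
  unfolding total_def service_def phase_def sum_states ..

lemma mass_eq_sum: "\<xi> > 0 \<Longrightarrow> mass m i \<xi> = (\<Sum>h=1..k1 P + k2 P + 2. \<Sum>n. f m i \<xi> n h)"
  unfolding mass_def total_eq_sum by (rule suminf_sum) (rule summable_f)

lemma mass_derivative:
  assumes "\<xi> > 0"
  shows "(mass m i has_real_derivative mass m (Suc i) \<xi>) (at \<xi>)"
proof -
  have "((\<lambda>x. \<Sum>h=1..k1 P + k2 P + 2. \<Sum>n. f m i x n h) has_real_derivative mass m (Suc i) \<xi>) (at \<xi>)"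
    unfolding mass_eq_sum[OF assms] using assms by (intro DERIV_sum suminf_f_derivative) auto
  then show ?thesis
    by (rule has_field_derivative_transform_within_open[of _ _ _ "{0<..}"]) (use assms mass_eq_sum in auto)
qed

lemma suminf_phase_derivative:
  "j \<le> J \<Longrightarrow> \<xi> > 0 \<Longrightarrow>
    ((\<lambda>x. suminf (phase m i x j)) has_real_derivative suminf (phase m (Suc i) \<xi> j)) (at \<xi>)"
  unfolding phase_def by (intro suminf_f_derivative) auto

lemma service_0: "\<xi> > 0 \<Longrightarrow> service m i \<xi> 0 = 0"
  unfolding service_def f_def by (intro sum.neutral ballI deriv_iterate_zero vanish)

text \<open>As in the lumped equation, phase 0 also carries the services at the first queue.\<close>

definition arrivals :: "nat \<Rightarrow> real \<Rightarrow> nat \<Rightarrow> nat \<Rightarrow> real" where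
  "arrivals m \<xi> j n = arrival_coeff L \<omega> m
    (\<lambda>m i. if j = 0 then service m i \<xi> n + phase m i \<xi> 0 n else phase m i \<xi> j n)"

lemma first_equation:
  assumes "\<xi> > 0" "m \<le> 2"
  shows "lam1 P * nabla (\<lambda>n. service m 0 \<xi> n + phase m 0 \<xi> 0 n) n + mu1 P * service m 0 \<xi> n
      + r 0 * phase m 0 \<xi> 0 n + arrivals m \<xi> 0 n
    = mu1 P * service m 0 \<xi> (Suc n) + r J * phase m 0 \<xi> J n"
proof -
  have A: "(\<Sum>h=1..k1 P + 1. f m i \<xi> n h) = service m i \<xi> n + phase m i \<xi> 0 n" for m i n
    by (simp add: service_def phase_def)
  have "r 0 = sig1 P" "r J = sig2 P"
    by (auto simp: phase_rate_def)
  then show ?thesis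
    using order_first[OF k_pos bal vanish assms, of n]
    unfolding f_def[symmetric] A arrivals_def
    unfolding phase_def service_def L_eq by simp
qed

lemma later_equation:
  assumes "\<xi> > 0" "m \<le> 2" "1 \<le> j" "j \<le> J"
  shows "lam1 P * nabla (phase m 0 \<xi> j) n + r j * phase m 0 \<xi> j n + arrivals m \<xi> j n
    = r (j - 1) * shift_coeff (s (j - 1)) m (\<lambda>m i. phase m i \<xi> (j - 1) n)"
  using order_later[OF k_pos bal vanish assms, of n] assms(3)
  unfolding f_def[symmetric] arrivals_def phase_def L_eq by simp

text \<open>The sources at order 1 are \<xi>-derivatives of order-0 coefficients. Differentiating
  the order-0 equations shows that these solve them too, as \<open>first_order\<close>
  requires.\<close>

lemma order_zero_derivative:
  assumes \<xi>: "\<xi> > 0"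
  shows "lam1 P * nabla (\<lambda>n. service 0 1 \<xi> n + phase 0 1 \<xi> 0 n) n + mu1 P * service 0 1 \<xi> n
      + r 0 * phase 0 1 \<xi> 0 n = mu1 P * service 0 1 \<xi> (Suc n) + r J * phase 0 1 \<xi> J n"
    and "1 \<le> j \<Longrightarrow> j \<le> J \<Longrightarrow>
      lam1 P * nabla (phase 0 1 \<xi> j) n + r j * phase 0 1 \<xi> j n = r (j - 1) * phase 0 1 \<xi> (j - 1) n"
proof -
  show "lam1 P * nabla (\<lambda>n. service 0 1 \<xi> n + phase 0 1 \<xi> 0 n) n + mu1 P * service 0 1 \<xi> n
      + r 0 * phase 0 1 \<xi> 0 n = mu1 P * service 0 1 \<xi> (Suc n) + r J * phase 0 1 \<xi> J n"
  proof (rule derivatives_eq[OF _ \<xi>])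
    show "lam1 P * nabla (\<lambda>n. service 0 0 x n + phase 0 0 x 0 n) n + mu1 P * service 0 0 x n
      + r 0 * phase 0 0 x 0 n = mu1 P * service 0 0 x (Suc n) + r J * phase 0 0 x J n" if "x > 0" for x
      using first_equation[OF that, of 0 n] by (simp add: arrivals_def arrival_coeff_def)
  qed (use \<xi> in \<open>auto intro!: DERIV_add DERIV_cmult has_derivative_nabla service_derivative[where i = 0, simplified]
      phase_derivative[where i = 0, simplified]\<close>)
  show "lam1 P * nabla (phase 0 1 \<xi> j) n + r j * phase 0 1 \<xi> j n = r (j - 1) * phase 0 1 \<xi> (j - 1) n"
    if j: "1 \<le> j" "j \<le> J"
  proof (rule derivatives_eq[OF _ \<xi>])
    show "lam1 P * nabla (phase 0 0 x j) n + r j * phase 0 0 x j n = r (j - 1) * phase 0 0 x (j - 1) n"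
      if "x > 0" for x
      using later_equation[OF that _ j, of 0 n] by (simp add: arrivals_def arrival_coeff_def shift_coeff_def)
  qed (use \<xi> j in \<open>auto intro!: DERIV_add DERIV_cmult has_derivative_nabla
      phase_derivative[where i = 0, simplified]\<close>)
qed

lemma flux_mass:
  assumes "\<xi> > 0"
  shows "(\<Sum>j\<le>J. s j * (r j * suminf (phase 0 1 \<xi> j))) = L * mass 0 1 \<xi>"
  unfolding mass_def
  by (rule flux_total_suminf) (use assms order_zero_derivative summable_service summable_phase service_0 in auto)

text \<open>\<open>first_order\<close>, with the common flux rewritten as a multiple of the mass by
  \<open>total_suminf\<close>.\<close>

lemma first_order_mass:
  assumes \<xi>: "\<xi> > 0"
  shows "L * mass 1 0 \<xi> - (\<Sum>j\<le>J. s j * (r j * suminf (phase 1 0 \<xi> j)))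
    = kappa * ((1 - lam1 P / mu1 P) / T) * mass 0 1 \<xi>"
proof -
  have "L * mass 1 0 \<xi> - (\<Sum>j\<le>J. s j * (r j * suminf (phase 1 0 \<xi> j)))
    = kappa * (r 0 * suminf (phase 0 1 \<xi> 0))"
    unfolding mass_def
  proof (rule first_order[where x = "service 0 1 \<xi>" and c = "phase 0 1 \<xi>"])
    show "lam1 P * nabla (\<lambda>n. service 1 0 \<xi> n + phase 1 0 \<xi> 0 n) n + mu1 P * service 1 0 \<xi> n
      + r 0 * phase 1 0 \<xi> 0 n + L * (service 0 1 \<xi> n + phase 0 1 \<xi> 0 n)
      = mu1 P * service 1 0 \<xi> (Suc n) + r J * phase 1 0 \<xi> J n" for n
      using first_equation[OF \<xi>, of 1 n] by (simp add: arrivals_def arrival_coeff_def)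
    show "lam1 P * nabla (phase 1 0 \<xi> j) n + r j * phase 1 0 \<xi> j n + L * phase 0 1 \<xi> j n
      = r (j - 1) * (phase 1 0 \<xi> (j - 1) n + s (j - 1) * phase 0 1 \<xi> (j - 1) n)"
      if "1 \<le> j" "j \<le> J" for j n
      using later_equation[OF \<xi> _ that, of 1 n] that by (simp add: arrivals_def arrival_coeff_def shift_coeff_def)
  qed (use \<xi> order_zero_derivative summable_service summable_phase service_0 in auto)
  moreover have wM: "(1 - lam1 P / mu1 P) * mass 0 1 \<xi> = T * (r 0 * suminf (phase 0 1 \<xi> 0))"
    unfolding mass_def
    by (rule total_suminf) (use \<xi> order_zero_derivative summable_service summable_phase service_0 in auto)
  moreover have "kappa * ((1 - lam1 P / mu1 P) / T) * mass 0 1 \<xi> = kappa * ((1 - lam1 P / mu1 P) * mass 0 1 \<xi>) / T"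
    by simp
  moreover have "kappa * (T * (r 0 * suminf (phase 0 1 \<xi> 0))) / T = kappa * (r 0 * suminf (phase 0 1 \<xi> 0))"
    using T_pos by simp
  ultimately show ?thesis
    by (simp only:)
qed

text \<open>In the total balance at order 2, the order-2 coefficients occur only under a backward
  difference. Summation over \<open>n1\<close> removes them and leaves a relation between the orders
  0 and 1.\<close>

lemma second_order_mass:
  assumes \<xi>: "\<xi> > 0"
  shows "L * (mass 1 1 \<xi> - mass 0 2 \<xi> / 2) - \<omega> * mass 0 1 \<xi>
    = (\<Sum>j\<le>J. s j * (r j * suminf (phase 1 1 \<xi> j))) + (\<Sum>j\<le>J. s j * (r j * suminf (phase 0 2 \<xi> j))) / 2"
proof -
  define g where "g j n = r j * (s j * phase 1 1 \<xi> j n + (s j)\<^sup>2 * phase 0 2 \<xi> j n / 2)" for j n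
  let ?N = "nabla (\<lambda>n. lam1 P * total (service 2 0 \<xi>) (phase 2 0 \<xi>) n - mu1 P * service 2 0 \<xi> (Suc n))"
  have "?N n + (\<Sum>j\<le>J. arrivals 2 \<xi> j n) = (\<Sum>j<J. g j n)" for n
    by (rule total_balance)
      (use first_equation[OF \<xi>, of 2] later_equation[OF \<xi>, of 2] service_0[OF \<xi>] in
        \<open>auto simp: g_def shift_coeff_def algebra_simps\<close>)
  moreover have "(\<Sum>j\<le>J. arrivals 2 \<xi> j n) = L * (total (service 1 1 \<xi>) (phase 1 1 \<xi>) n
      - total (service 0 2 \<xi>) (phase 0 2 \<xi>) n / 2) - \<omega> * total (service 0 1 \<xi>) (phase 0 1 \<xi>) n" for n
  proof -
    have arr: "arrivals 2 \<xi> j n = L * phase 1 1 \<xi> j n - L / 2 * phase 0 2 \<xi> j n - \<omega> * phase 0 1 \<xi> j n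
      + (if j = 0 then L * service 1 1 \<xi> n - L / 2 * service 0 2 \<xi> n - \<omega> * service 0 1 \<xi> n else 0)" for j
      by (simp add: arrivals_def arrival_coeff_def algebra_simps)
    show ?thesis
      unfolding arr sum.distrib sum_subtractf sum_distrib_left[symmetric] total_def
      by (simp add: algebra_simps)
  qed
  ultimately have eq: "?N n + (L * (total (service 1 1 \<xi>) (phase 1 1 \<xi>) n
      - total (service 0 2 \<xi>) (phase 0 2 \<xi>) n / 2) - \<omega> * total (service 0 1 \<xi>) (phase 0 1 \<xi>) n) = (\<Sum>j<J. g j n)" for n
    by simp
  have tot: "summable (total (service m i \<xi>) (phase m i \<xi>))" for m i
    unfolding total_def using \<xi> by (intro summable_add summable_sum summable_service summable_phase) auto
  have N: "?N sums 0"
    using \<xi> by (intro nabla_sums_0 summable_diff summable_mult tot) (simp add: summable_Suc_iff summable_service)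
  have "(\<lambda>n. ?N n + (L * (total (service 1 1 \<xi>) (phase 1 1 \<xi>) n
      - total (service 0 2 \<xi>) (phase 0 2 \<xi>) n / 2) - \<omega> * total (service 0 1 \<xi>) (phase 0 1 \<xi>) n))
    sums (0 + (L * (mass 1 1 \<xi> - mass 0 2 \<xi> / 2) - \<omega> * mass 0 1 \<xi>))"
    unfolding mass_def
    by (intro sums_add sums_diff sums_mult sums_divide N summable_sums tot)
  moreover have "(\<lambda>n. \<Sum>j<J. g j n) sums
    (\<Sum>j<J. r j * (s j * suminf (phase 1 1 \<xi> j) + (s j)\<^sup>2 * suminf (phase 0 2 \<xi> j) / 2))"
    unfolding g_def using \<xi>
    by (intro sums_sum sums_mult sums_add sums_divide summable_sums summable_phase) auto
  ultimately have "L * (mass 1 1 \<xi> - mass 0 2 \<xi> / 2) - \<omega> * mass 0 1 \<xi>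
    = (\<Sum>j<J. r j * (s j * suminf (phase 1 1 \<xi> j) + (s j)\<^sup>2 * suminf (phase 0 2 \<xi> j) / 2))"
    unfolding eq using sums_unique2 by fastforce
  also have "\<dots> = (\<Sum>j\<le>J. r j * (s j * suminf (phase 1 1 \<xi> j) + (s j)\<^sup>2 * suminf (phase 0 2 \<xi> j) / 2))"
    using s_J by (simp add: lessThan_Suc_atMost[symmetric])
  \<comment> \<open>Here \<open>s j\<close> is 0 or 1, hence equal to its square.\<close>
  also have "\<dots> = (\<Sum>j\<le>J. s j * (r j * suminf (phase 1 1 \<xi> j)) + s j * (r j * suminf (phase 0 2 \<xi> j)) / 2)"
    by (intro sum.cong refl) (simp add: departs_def distrib_left)
  finally show ?thesis
    unfolding sum.distrib sum_divide_distrib .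
qed

text \<open>Order 1 enters \<open>second_order_mass\<close> only through the \<xi>-derivative of the
  defect in \<open>first_order_mass\<close>. Substituting it closes the equation for the order-0
  mass.\<close>

theorem mass_ode:
  assumes \<xi>: "\<xi> > 0"
  shows "mass 0 2 \<xi> = - eta P \<omega> * mass 0 1 \<xi>"
proof -
  let ?w = "1 - lam1 P / mu1 P" and ?k = "real (k2 P)" and ?E = "mean_B2 P"
  let ?D = "2 * (lam1 P / (mu1 P)\<^sup>2) + 1 / ?E * ?w * second_moment_B2 P"
  have mass_derivs: "(mass 1 0 has_real_derivative mass 1 1 \<xi>) (at \<xi>)"
    "(mass 0 1 has_real_derivative mass 0 2 \<xi>) (at \<xi>)"
    using mass_derivative[OF \<xi>, of 1 0] mass_derivative[OF \<xi>, of 0 1] by (simp_all add: numeral_2_eq_2)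
  have flux_deriv: "((\<lambda>x. \<Sum>j\<le>J. s j * (r j * suminf (phase m i x j))) has_real_derivative
      (\<Sum>j\<le>J. s j * (r j * suminf (phase m (Suc i) \<xi> j)))) (at \<xi>)" for m i
    by (intro DERIV_sum DERIV_cmult suminf_phase_derivative \<xi>) simp
  have flux2: "(\<Sum>j\<le>J. s j * (r j * suminf (phase 0 2 \<xi> j))) = L * mass 0 2 \<xi>"
  proof (rule derivatives_eq[OF _ \<xi>])
    show "(\<Sum>j\<le>J. s j * (r j * suminf (phase 0 1 x j))) = L * mass 0 1 x" if "x > 0" for x
      by (rule flux_mass[OF that])
    show "((\<lambda>x. \<Sum>j\<le>J. s j * (r j * suminf (phase 0 1 x j))) has_real_derivative
      (\<Sum>j\<le>J. s j * (r j * suminf (phase 0 2 \<xi> j)))) (at \<xi>)"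
      using flux_deriv[of 0 1] unfolding Suc_1 .
  qed (intro DERIV_cmult mass_derivs)
  have "L * mass 1 1 \<xi> - (\<Sum>j\<le>J. s j * (r j * suminf (phase 1 1 \<xi> j))) = kappa * (?w / T) * mass 0 2 \<xi>"
  proof (rule derivatives_eq[OF _ \<xi>])
    show "L * mass 1 0 x - (\<Sum>j\<le>J. s j * (r j * suminf (phase 1 0 x j))) = kappa * (?w / T) * mass 0 1 x"
      if "x > 0" for x
      by (rule first_order_mass[OF that])
  qed (intro DERIV_diff DERIV_cmult mass_derivs flux_deriv[where i = 0, folded One_nat_def])+
  then have "kappa * (?w / T) * mass 0 2 \<xi> = L * mass 0 2 \<xi> + \<omega> * mass 0 1 \<xi>"
    using second_order_mass[OF \<xi>] flux2 by (simp add: algebra_simps)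
  moreover have "L = ?w * ?k / T"
    unfolding L_def kappa_polling(3)[OF adm less] ..
  moreover have "w * (?k - kappa) / T * M = w * ?k / T * M - kappa * (w / T) * M" for w M
    by (simp add: algebra_simps diff_divide_distrib)
  ultimately have ode: "?w * (?k - kappa) / T * mass 0 2 \<xi> = - \<omega> * mass 0 1 \<xi>"
    by simp
  have k: "?k > 0" using k_pos by simp
  have T: "T = ?k * ?E" by (rule kappa_polling(2)[OF adm less])
  then have E: "?E > 0" using T_pos k by (simp add: zero_less_mult_iff)
  have D: "2 * ?w * (?k - kappa) * ?E = ?k * ?D" by (rule kappa_polling(5)[OF adm less])
  have "w * q / (?k * ?E) = d / (2 * ?E\<^sup>2)" if "2 * w * q * ?E = ?k * d" for w q d
    using that k E by (simp add: divide_simps power2_eq_square mult_ac)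
  from this[OF D] have coeff: "?w * (?k - kappa) / T = ?D / (2 * ?E\<^sup>2)"
    unfolding T .
  have ode': "?D / (2 * ?E\<^sup>2) * mass 0 2 \<xi> = - \<omega> * mass 0 1 \<xi>"
    using ode unfolding coeff .
  have D_pos: "?D > 0"
    using adm rho_less_1 E by (auto simp: admissible_def second_moment_B2_def var_B2_def var_S_def
        intro!: add_pos_nonneg mult_nonneg_nonneg divide_pos_pos)
  have "M = - (2 * \<omega> * ?E\<^sup>2 / d) * M'" if "d / (2 * ?E\<^sup>2) * M = - \<omega> * M'" "d > 0" for d M M'
    using that E by (simp add: field_simps)
  from this[OF ode' D_pos] show ?thesis
    unfolding eta_def .
qed

end

section \<open>Integrable solutions of the differential equation\<close>

lemma has_integral_const_unbounded:
  assumes "((\<lambda>_. D) has_integral I) {0::real<..}"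
  shows "D = (0::real)"
proof -
  \<comment> \<open>The other sign follows by applying this to the negated constant.\<close>
  have "D \<le> 0" if int: "((\<lambda>_. D) has_integral I) {0::real<..}" for D I :: real
  proof (rule ccontr)
    assume "\<not> D \<le> 0"
    then have D: "D > 0" by linarith
    have bound: "D * real n \<le> I" for n :: nat
    proof -
      have "((\<lambda>_. D) has_integral (real (Suc n) - 1) * D) {1..real (Suc n)}"
        using has_integral_const_real[of D 1 "real (Suc n)"] by simp
      from has_integral_subset_le[OF _ this int] show ?thesis
        using D by (auto simp: mult.commute subset_iff)
    qed
    obtain n :: nat where "I / D < real n"
      using reals_Archimedean2 by blast
    then show False
      using bound[of n] D by (simp add: divide_less_eq mult.commute)
  qed
  from this[OF assms] this[OF has_integral_neg[OF assms]] show ?thesis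
    by simp
qed

text \<open>Two first integrals, \<open>f' x * exp (\<eta> * x)\<close> and
  \<open>f x + f' x / \<eta>\<close>, give a constant plus an exponential. The exponential is
  integrable, so the constant would have to be, and is 0; normalization fixes the factor.\<close>

lemma exponential_density:
  fixes f f' :: "real \<Rightarrow> real"
  assumes f: "\<And>\<xi>. \<xi> > 0 \<Longrightarrow> (f has_real_derivative f' \<xi>) (at \<xi>)"
    and f': "\<And>\<xi>. \<xi> > 0 \<Longrightarrow> (f' has_real_derivative - \<eta> * f' \<xi>) (at \<xi>)"
    and \<eta>: "\<eta> > 0" and int: "(f has_integral 1) {0<..}" and "\<xi> > 0"
  shows "f \<xi> = \<eta> * exp (- \<eta> * \<xi>)"
proof -
  have "\<exists>A. \<forall>x\<in>{0<..}. f' x * exp (\<eta> * x) = A"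
  proof (rule has_field_derivative_zero_constant)
    fix x :: real assume "x \<in> {0<..}"
    then have "((\<lambda>x. f' x * exp (\<eta> * x)) has_real_derivative 0) (at x)"
      by (auto intro!: derivative_eq_intros f' simp: algebra_simps)
    then show "((\<lambda>x. f' x * exp (\<eta> * x)) has_real_derivative 0) (at x within {0<..})"
      by (rule has_field_derivative_at_within)
  qed simp
  then obtain A where A: "\<And>x. x > 0 \<Longrightarrow> f' x * exp (\<eta> * x) = A"
    by auto
  have "\<exists>D. \<forall>x\<in>{0<..}. f x + f' x / \<eta> = D"
  proof (rule has_field_derivative_zero_constant)
    fix x :: real assume "x \<in> {0<..}"
    then have "((\<lambda>x. f x + f' x / \<eta>) has_real_derivative 0) (at x)"
      using \<eta> by (auto intro!: derivative_eq_intros f f' simp: algebra_simps)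
    then show "((\<lambda>x. f x + f' x / \<eta>) has_real_derivative 0) (at x within {0<..})"
      by (rule has_field_derivative_at_within)
  qed simp
  then obtain D where D: "\<And>x. x > 0 \<Longrightarrow> f x + f' x / \<eta> = D"
    by auto
  define C where "C = - A / \<eta>"
  have fx: "f x = D + C * exp (- \<eta> * x)" if "x > 0" for x
  proof -
    have "f' x = A * exp (- \<eta> * x)"
      unfolding A[OF that, symmetric] by (simp add: mult.assoc mult_exp_exp)
    then show ?thesis
      using D[OF that] by (simp add: C_def)
  qed
  have "((\<lambda>x. exp (- \<eta> * x)) has_integral exp (- \<eta> * 0) / \<eta>) {0..}"
    using \<eta> by (rule has_integral_exp_minus_to_infinity)
  then have "((\<lambda>x. exp (- \<eta> * x)) has_integral 1 / \<eta>) {0<..}"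
    by (subst has_integral_spike_set_eq[of _ "{0..}"]) (auto intro: negligible_subset[of "{0}"])
  from has_integral_mult_right[OF this, of C]
  have e: "((\<lambda>x. C * exp (- \<eta> * x)) has_integral C / \<eta>) {0<..}"
    by simp
  from has_integral_diff[OF int this]
  have "((\<lambda>_. D) has_integral 1 - C / \<eta>) {0::real<..}"
    by (rule has_integral_eq[rotated]) (simp add: fx)
  then have D0: "D = 0"
    by (rule has_integral_const_unbounded)
  have "((\<lambda>x. C * exp (- \<eta> * x)) has_integral 1) {0<..}"
    using int by (rule has_integral_eq[rotated]) (simp add: fx D0)
  with e have "C / \<eta> = 1"
    by (rule has_integral_unique)
  with fx[OF \<open>\<xi> > 0\<close>] D0 \<eta> show ?thesis
    by simp
qed

theorem theorem2:
  fixes P :: "real polling" and \<omega> :: real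
    and p :: "real \<Rightarrow> nat \<times> nat \<times> nat \<Rightarrow> real"
    and \<phi> :: "nat \<Rightarrow> nat \<Rightarrow> real \<Rightarrow> real \<Rightarrow> real"
    and c :: "nat \<Rightarrow> nat \<Rightarrow> nat \<Rightarrow> real \<Rightarrow> real"
  assumes "admissible P" and "\<omega> > 0"
    and "\<forall>\<^sub>F \<delta> in at_right 0. lam1 P / real (k1 P) < heavy_lam2 P \<omega> \<delta> / real (k2 P)"
    and "scaled_stationary P \<omega> p \<phi>"
    and "expansion P \<phi> c"
    and "balanced_order_by_order P \<omega> c"
    and "termwise_summable P c"
    and "(leading_density P c has_integral 1) {0<..}"
  shows "\<forall>\<xi>>0. leading_density P c \<xi> = eta P \<omega> * exp (- eta P \<omega> * \<xi>)"
proof -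
  have pos: "lam1 P > 0" "mu1 P > 0" "mu2 P > 0" "sig1 P > 0" "sig2 P > 0" "k1 P \<ge> 1" "k2 P \<ge> 1"
    using assms(1) by (auto simp: admissible_def)
  then have E: "mean_B2 P > 0"
    by (auto simp: mean_B2_def mean_S_def intro!: add_pos_pos divide_pos_pos)
  \<comment> \<open>One small \<delta> suffices: there \<open>heavy_lam2\<close> is positive, hence
    so is \<open>critical_lam2\<close>, and thus \<open>lam1 P < mu1 P\<close>.\<close>
  obtain \<delta> where \<delta>: "lam1 P / real (k1 P) < heavy_lam2 P \<omega> \<delta> / real (k2 P)" "\<delta> > 0"
    using eventually_happens'[OF trivial_limit_at_right_real
        eventually_conj[OF assms(3) eventually_at_right_less[of 0]]] by blast
  have "0 < lam1 P / real (k1 P)"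
    using pos by simp
  then have "0 < heavy_lam2 P \<omega> \<delta> / real (k2 P)"
    using \<delta>(1) by linarith
  then have "0 < heavy_lam2 P \<omega> \<delta>"
    using pos by (simp add: zero_less_divide_iff)
  moreover have "0 < \<delta> * \<omega>"
    using \<delta>(2) assms(2) by simp
  ultimately have "0 < critical_lam2 P"
    unfolding heavy_lam2_def by linarith
  then have rho: "0 < 1 - lam1 P / mu1 P"
    using E by (simp add: critical_lam2_def zero_less_divide_iff)
  then have less: "lam1 P < mu1 P"
    using pos by simp
  interpret heavy_traffic P \<omega> c
    using assms(1) less assms(6) coeff_vanishes_off_states[OF assms(4,5)] assms(5,7)
    by unfold_locales (auto simp: expansion_def)
  have "eta P \<omega> > 0"
    using E rho pos assms(2)
    by (auto simp: eta_def second_moment_B2_def var_B2_def var_S_def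
        intro!: divide_pos_pos mult_pos_pos add_pos_nonneg mult_nonneg_nonneg)
  moreover have density: "leading_density P c = mass 0 0"
    by (rule ext) (simp only: leading_density_def mass_def total_eq_sum f_def funpow_0)
  moreover have "(mass 0 0 has_real_derivative mass 0 1 \<xi>) (at \<xi>)" if "\<xi> > 0" for \<xi>
    using mass_derivative[OF that, of 0 0] by simp
  moreover have "(mass 0 1 has_real_derivative - eta P \<omega> * mass 0 1 \<xi>) (at \<xi>)" if "\<xi> > 0" for \<xi>
    using mass_derivative[OF that, of 0 1] mass_ode[OF that] by (simp add: numeral_2_eq_2)
  moreover have "(mass 0 0 has_integral 1) {0<..}"
    using assms(8) unfolding density .
  ultimately show ?thesis
    using exponential_density[of "mass 0 0" "mass 0 1" "eta P \<omega>"] by simp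
qed

end
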